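(* Let $n\ge 4$ and $\ell=n-3$. The set of $01$ cell-forms $\omega_{(0,1,\pi)}$, where $\pi$ runs over all orderings of the set $\{t_1,\ldots,t_\ell,\infty\}$, has cardinality $(n-2)!$, and (the classes of) its elements form a basis of the $\mathbb{Q}$-vector space $H^\ell(\mathfrak{M}_{0,n},\mathbb{Q})$.
   Context: $\mathfrak{M}_{0,n}$ is the moduli space of genus $0$ curves with $n$ ordered marked points $z_1,\ldots,z_n$. Normalizing $z_1=0$, $z_{n-1}=1$, $z_n=\infty$ and setting $t_i=z_{i+1}$ for $1\le i\le \ell=n-3$, it is identified with $\{(t_1,\ldots,t_\ell): t_i\ne 0,1,\infty,\ t_i\ne t_j \text{ for } i\neq j\}$. $H^\ell(\mathfrak{M}_{0,n},\mathbb{Q})$ denotes its algebraic de Rham cohomology over $\mathbb{Q}$ in degree $\ell$. Cell-forms: given a cyclic ordering $\gamma$ of $\{0,t_1,\ldots,t_\ell,1,\infty\}$, rotate it so that $\infty$ is in last position, $\gamma=(y_1,\ldots,y_{n-1},\infty)$; the associated cell-form is $$\omega_\gamma=[y_1,\ldots,y_{n-1},\infty]=\frac{dt_1\cdots dt_\ell}{(y_2-y_1)(y_3-y_2)\cdots(y_{n-1}-y_{n-2})}.$$ A $01$ cell-form is the cell-form $\omega_{(0,1,\pi)}$ of a cyclic ordering of the form $(0,1,\pi)$, where $\pi$ is an ordering of $\{t_1,\ldots,t_\ell,\infty\}$. *)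

theory Defs
  imports
    "HOL-Library.Poly_Mapping"
    "HOL-Computational_Algebra.Fraction_Field"
    "HOL-Combinatorics.Multiset_Permutations"
    "HOL-Algebra.AbelCoset"
    "Jordan_Normal_Form.VS_Connect"
begin

section \<open>Rational functions and their partial derivatives\<close>

text \<open>A polynomial over \<open>\<rat>\<close> in the variables \<open>t\<^sub>0, t\<^sub>1, \<dots>\<close> is a finitely supported function
  from exponent vectors to coefficients; only \<open>t\<^sub>1, \<dots>, t\<^sub>l\<close> will be used.\<close>

type_synonym qpoly = "(nat \<Rightarrow>\<^sub>0 nat) \<Rightarrow>\<^sub>0 rat"
type_synonym ratfun = "qpoly fract"

definition const :: "rat \<Rightarrow> ratfun" where
  "const c = Fract (Poly_Mapping.single 0 c) 1"

definition tvar :: "nat \<Rightarrow> ratfun" where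
  "tvar i = Fract (Poly_Mapping.single (Poly_Mapping.single i 1) 1) 1"

definition poly_pd :: "nat \<Rightarrow> qpoly \<Rightarrow> qpoly" where
  "poly_pd i p = (\<Sum>m\<in>Poly_Mapping.keys p.
     Poly_Mapping.single (m - Poly_Mapping.single i 1)
       (of_nat (Poly_Mapping.lookup m i) * Poly_Mapping.lookup p m))"

lemma poly_pd_superset:
  assumes "finite A" "Poly_Mapping.keys p \<subseteq> A"
  shows "poly_pd i p = (\<Sum>m\<in>A. Poly_Mapping.single (m - Poly_Mapping.single i 1)
       (of_nat (Poly_Mapping.lookup m i) * Poly_Mapping.lookup p m))"
  unfolding poly_pd_def
  by (rule sum.mono_neutral_left) (use assms in \<open>auto simp: in_keys_iff\<close>)

lemma poly_pd_zero [simp]: "poly_pd i 0 = 0"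
  by (simp add: poly_pd_def)

lemma poly_pd_add: "poly_pd i (p + q) = poly_pd i p + poly_pd i q"
proof -
  let ?A = "Poly_Mapping.keys p \<union> Poly_Mapping.keys q"
  have "Poly_Mapping.keys (p + q) \<subseteq> ?A" by (rule Poly_Mapping.keys_add)
  then show ?thesis
    by (subst (1 2 3) poly_pd_superset[of ?A])
      (auto simp: lookup_add distrib_left single_add sum.distrib)
qed

lemma poly_pd_single:
  "poly_pd i (Poly_Mapping.single m c) =
     Poly_Mapping.single (m - Poly_Mapping.single i 1) (of_nat (Poly_Mapping.lookup m i) * c)"
  by (subst poly_pd_superset[of "{m}"]) auto

lemma poly_pd_single_mult:
  "poly_pd i (Poly_Mapping.single m a * Poly_Mapping.single k b) =
     poly_pd i (Poly_Mapping.single m a) * Poly_Mapping.single k b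
     + Poly_Mapping.single m a * poly_pd i (Poly_Mapping.single k b)"
proof -
  let ?e = "Poly_Mapping.single i (1::nat)"
  have shift: "Poly_Mapping.single (m + k - ?e) (of_nat (Poly_Mapping.lookup m i) * c) =
      Poly_Mapping.single (m - ?e + k) (of_nat (Poly_Mapping.lookup m i) * c)" for m k and c :: rat
  proof (cases "Poly_Mapping.lookup m i = 0")
    case False
    then have "m + k - ?e = m - ?e + k"
      by (intro poly_mapping_eqI) (auto simp: lookup_add lookup_minus lookup_single when_def)
    then show ?thesis by simp
  qed auto
  show ?thesis
    using shift[of m k "a * b"] shift[of k m "a * b"]
    by (simp add: poly_pd_single mult_single lookup_add single_add distrib_right
        distrib_left ac_simps)
qed

lemma poly_pd_mult: "poly_pd i (p * q) = poly_pd i p * q + p * poly_pd i q"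
proof -
  have sum: "poly_pd i (\<Sum>x\<in>A. f x) = (\<Sum>x\<in>A. poly_pd i (f x))"
    for A :: "(nat \<Rightarrow>\<^sub>0 nat) set" and f
    by (induction A rule: infinite_finite_induct) (auto simp: poly_pd_add)
  have decomp: "r = (\<Sum>m\<in>Poly_Mapping.keys r. Poly_Mapping.single m (Poly_Mapping.lookup r m))"
    for r :: qpoly
    by (rule poly_mapping_eqI) (auto simp: lookup_sum lookup_single when_def in_keys_iff)
  have 1: "poly_pd i (Poly_Mapping.single m a * q) =
      poly_pd i (Poly_Mapping.single m a) * q + Poly_Mapping.single m a * poly_pd i q" for m a
    by (subst (1 2 3) decomp[of q])
      (simp only: sum sum_distrib_left poly_pd_single_mult sum.distrib)
  show ?thesis
    by (subst (1 2 3) decomp[of p])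
      (simp only: sum sum_distrib_right 1 sum.distrib)
qed

definition pd :: "nat \<Rightarrow> ratfun \<Rightarrow> ratfun" where
  "pd i f = (THE g. \<exists>p q. q \<noteq> 0 \<and> f = Fract p q \<and>
     g = Fract (poly_pd i p * q - p * poly_pd i q) (q * q))"

lemma pd_Fract:
  assumes "q \<noteq> 0"
  shows "pd i (Fract p q) = Fract (poly_pd i p * q - p * poly_pd i q) (q * q)"
  unfolding pd_def
proof (rule the_equality)
  fix g
  assume "\<exists>a b. b \<noteq> 0 \<and> Fract p q = Fract a b \<and>
     g = Fract (poly_pd i a * b - a * poly_pd i b) (b * b)"
  then obtain a b where b: "b \<noteq> 0" and eq: "Fract p q = Fract a b"
    and g: "g = Fract (poly_pd i a * b - a * poly_pd i b) (b * b)" by blast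
  have e: "p * b = a * q" using eq assms b by (simp add: eq_fract)
  have e': "poly_pd i p * b + p * poly_pd i b = poly_pd i a * q + a * poly_pd i q"
    using arg_cong[OF e, of "poly_pd i"] by (simp add: poly_pd_mult)
  have "(poly_pd i a * b - a * poly_pd i b) * (q * q) =
      (poly_pd i p * q - p * poly_pd i q) * (b * b)"
  proof -
    have "(a' * b - a * b') * (q * q) - (p' * q - p * q') * (b * b) =
        b * q * ((a' * q + a * q') - (p' * b + p * b')) + (q * b' + b * q') * (p * b - a * q)"
      for a' b' p' q' :: qpoly
      by (simp add: algebra_simps)
    then show ?thesis
      using e e' by (metis (no_types, lifting) add_0 cancel_comm_monoid_add_class.diff_cancel
          eq_iff_diff_eq_0 mult_zero_right)
  qed
  then show "g = Fract (poly_pd i p * q - p * poly_pd i q) (q * q)"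
    using assms b by (simp add: g eq_fract)
qed (use assms in blast)


section \<open>The coordinate ring of the moduli space\<close>

text \<open>With \<open>l = n - 3\<close>, the space \<open>M\<^sub>0\<^sub>,\<^sub>n\<close> is the affine variety of all \<open>(t\<^sub>1, \<dots>, t\<^sub>l)\<close> on which the
  functions \<open>t\<^sub>i\<close>, \<open>t\<^sub>i - 1\<close> and \<open>t\<^sub>i - t\<^sub>j\<close> (\<open>i \<noteq> j\<close>) are invertible, so its ring of regular functions
  is the \<open>\<rat>\<close>-subalgebra of the rational function field generated by the \<open>t\<^sub>i\<close> and these inverses.\<close>

inductive_set coord_ring :: "nat \<Rightarrow> ratfun set" for n :: nat where
  const: "const c \<in> coord_ring n"
| tvar: "i \<in> {1..n - 3} \<Longrightarrow> tvar i \<in> coord_ring n"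
| inverse_0: "i \<in> {1..n - 3} \<Longrightarrow> inverse (tvar i) \<in> coord_ring n"
| inverse_1: "i \<in> {1..n - 3} \<Longrightarrow> inverse (tvar i - 1) \<in> coord_ring n"
| inverse_diff: "i \<in> {1..n - 3} \<Longrightarrow> j \<in> {1..n - 3} \<Longrightarrow> i \<noteq> j \<Longrightarrow>
    inverse (tvar i - tvar j) \<in> coord_ring n"
| add: "f \<in> coord_ring n \<Longrightarrow> g \<in> coord_ring n \<Longrightarrow> f + g \<in> coord_ring n"
| mult: "f \<in> coord_ring n \<Longrightarrow> g \<in> coord_ring n \<Longrightarrow> f * g \<in> coord_ring n"


section \<open>Algebraic de Rham cohomology\<close>

text \<open>The module of algebraic differentials is free over the coordinate ring on
  \<open>dt\<^sub>1, \<dots>, dt\<^sub>l\<close>. A differential form is encoded by its coefficients with respect to the forms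
  \<open>dt\<^sub>I = dt\<^bsub>i\<^sub>1\<^esub> \<and> \<dots> \<and> dt\<^bsub>i\<^sub>k\<^esub>\<close> with \<open>I = {i\<^sub>1 < \<dots> < i\<^sub>k}\<close>; thus
  \<^term>\<open>Poly_Mapping.single I f\<close> is \<open>f dt\<^sub>I\<close>. As the variety is affine, its algebraic de Rham
  cohomology is the cohomology of the complex of global forms.\<close>

type_synonym dform = "nat set \<Rightarrow>\<^sub>0 ratfun"

definition forms :: "nat \<Rightarrow> nat \<Rightarrow> dform set" where
  "forms n k = {\<omega>. \<forall>I\<in>Poly_Mapping.keys \<omega>.
     I \<subseteq> {1..n - 3} \<and> card I = k \<and> Poly_Mapping.lookup \<omega> I \<in> coord_ring n}"

definition scale_form :: "rat \<Rightarrow> dform \<Rightarrow> dform" where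
  "scale_form c = Poly_Mapping.map (\<lambda>f. const c * f)"

text \<open>\<open>d (f dt\<^sub>I) = (\<Sum>j. \<partial>f/\<partial>t\<^sub>j dt\<^sub>j \<and> dt\<^sub>I)\<close>; the sign comes from moving \<open>dt\<^sub>j\<close> to its place.\<close>

definition ext_d :: "nat \<Rightarrow> dform \<Rightarrow> dform" where
  "ext_d n \<omega> = (\<Sum>I\<in>Poly_Mapping.keys \<omega>. \<Sum>j\<in>{1..n - 3} - I.
     Poly_Mapping.single (insert j I)
       ((-1) ^ card {i\<in>I. i < j} * pd j (Poly_Mapping.lookup \<omega> I)))"

definition closed_forms :: "nat \<Rightarrow> nat \<Rightarrow> dform set" where
  "closed_forms n k = {\<omega> \<in> forms n k. ext_d n \<omega> = 0}"

definition exact_forms :: "nat \<Rightarrow> nat \<Rightarrow> dform set" where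
  "exact_forms n k = (case k of 0 \<Rightarrow> {0} | Suc j \<Rightarrow> ext_d n ` forms n j)"

text \<open>The fields \<open>mult\<close> and \<open>one\<close> of a module record are irrelevant to the module structure.\<close>

definition closed_module :: "nat \<Rightarrow> nat \<Rightarrow> (rat, dform) module" where
  "closed_module n k = \<lparr>carrier = closed_forms n k, mult = undefined, one = undefined,
     zero = 0, add = (+), smult = scale_form\<rparr>"

definition quotient_module ::
  "('a, 'b, 'm) module_scheme \<Rightarrow> 'b set \<Rightarrow> ('a, 'b set) module" where
  "quotient_module M N = \<lparr>carrier = a_rcosets\<^bsub>M\<^esub> N, mult = undefined, one = undefined,
     zero = N, add = (<+>\<^bsub>M\<^esub>), smult = (\<lambda>c A. \<Union>x\<in>A. N +>\<^bsub>M\<^esub> (c \<odot>\<^bsub>M\<^esub> x))\<rparr>"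

definition de_Rham :: "nat \<Rightarrow> nat \<Rightarrow> (rat, dform set) module" where
  "de_Rham n k = quotient_module (closed_module n k) (exact_forms n k)"

definition de_Rham_class :: "nat \<Rightarrow> nat \<Rightarrow> dform \<Rightarrow> dform set" where
  "de_Rham_class n k \<omega> = exact_forms n k +>\<^bsub>closed_module n k\<^esub> \<omega>"


section \<open>Cell-forms\<close>

datatype marked_point = Pt_0 | Pt_1 | Pt_inf | Pt_t nat

text \<open>The value at \<^const>\<open>Pt_inf\<close> is never used.\<close>

fun coord :: "marked_point \<Rightarrow> ratfun" where
  "coord Pt_0 = 0"
| "coord Pt_1 = 1"
| "coord (Pt_t i) = tvar i"
| "coord Pt_inf = undefined"

text \<open>A cyclic ordering is represented by any list obtained by cutting it open. Rotating
  \<^const>\<open>Pt_inf\<close> to the last position and then deleting it gives \<open>y\<^sub>1, \<dots>, y\<^bsub>n-1\<^esub>\<close>.\<close>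

definition before_infinity :: "marked_point list \<Rightarrow> marked_point list" where
  "before_infinity \<gamma> =
     tl (dropWhile (\<lambda>x. x \<noteq> Pt_inf) \<gamma>) @ takeWhile (\<lambda>x. x \<noteq> Pt_inf) \<gamma>"

lemma before_infinity_rotate:
  assumes "Pt_inf \<in> set \<gamma>"
  shows "\<exists>k. rotate k \<gamma> = before_infinity \<gamma> @ [Pt_inf]"
proof -
  let ?P = "\<lambda>x. x \<noteq> Pt_inf"
  let ?k = "length (takeWhile ?P \<gamma>)"
  have ne: "dropWhile ?P \<gamma> \<noteq> []" using assms by (simp add: dropWhile_eq_Nil_conv)
  moreover have "hd (dropWhile ?P \<gamma>) = Pt_inf" using hd_dropWhile[OF ne] by simp
  ultimately have d: "dropWhile ?P \<gamma> = Pt_inf # tl (dropWhile ?P \<gamma>)"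
    by (metis list.collapse)
  have "rotate ?k (takeWhile ?P \<gamma> @ dropWhile ?P \<gamma>) = dropWhile ?P \<gamma> @ takeWhile ?P \<gamma>"
    by (rule rotate_append)
  then have "rotate (Suc ?k) \<gamma> = rotate1 (dropWhile ?P \<gamma> @ takeWhile ?P \<gamma>)"
    by simp
  also have "\<dots> = before_infinity \<gamma> @ [Pt_inf]"
    unfolding before_infinity_def by (subst d) simp
  finally show ?thesis by blast
qed

definition cell_form :: "nat \<Rightarrow> marked_point list \<Rightarrow> dform" where
  "cell_form n \<gamma> = (let y = before_infinity \<gamma> in
     Poly_Mapping.single {1..n - 3} (1 / (\<Prod>i<length y - 1. coord (y ! Suc i) - coord (y ! i))))"

definition cell_forms_01 :: "nat \<Rightarrow> dform set" where
  "cell_forms_01 n =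
     {cell_form n (Pt_0 # Pt_1 # \<pi>) |\<pi>. \<pi> \<in> permutations_of_set (insert Pt_inf (Pt_t ` {1..n - 3}))}"

end

(*
  The top cohomology is the ring R_l of regular functions modulo the sum N_l of the images of the
  partial derivatives. Project M_{0,n} to M_{0,n-1} by forgetting t = t_l: by partial fractions in t,
  modulo exact functions R_l is spanned by the f/(t - b) with b a finite puncture of the fibre
  and f in R_{l-1}, and the residue along t = b maps N_l to N_{l-1}. Inserting t between
  neighbours x, y of a cyclic ordering multiplies the cell-form by 1/(t - x) - 1/(t - y), with the
  term of a neighbour at infinity omitted. Hence, for a 01 ordering of the remaining points,
  summing over all gaps from b to infinity telescopes to 1/(t - b), which gives spanning.
  Conversely, in a linear relation the residue at b forces the coefficients of the insertions
  immediately before and after b to agree; as t is never inserted between 0 and 1, all of them vanish.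
*)
theory Submission
  imports
    Defs
    "HOL-Computational_Algebra.Formal_Laurent_Series"
    "HOL-Computational_Algebra.Polynomial_FPS"
begin

section \<open>Calculus of rational functions\<close>

text \<open>Uniqueness of partial fractions is never proved. They only serve to cover all of R_l;
  what separates their terms is the residue, which is defined without any decomposition, as the
  coefficient of X^(-1) after the substitution t = b + X, an embedding of the rational function
  field into a field of Laurent series. As the expansion is taken around the moving point b, the
  residue commutes with d/dt_j even for b = t_j: the double pole that comes from differentiating b
  has no residue. In the other direction, multiplication by 1/(t - b) carries N_(l-1) into N_l; this
  allows the coefficient of a simple pole to be replaced, modulo exact functions, by a combination
  of cell functions from one dimension below. The count works because the circle opened between 0
  and 1 has l+1 gaps for t, as many as the fibre has finite punctures. For a fixed 01 ordering of
  the other points the residues thus give a square linear system. Infinity gives no equation, so the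
  system falls apart there into two chains, each anchored at one end of the opened circle.\<close>

lemma const_add: "const (c + d) = const c + const d"
  and const_mult: "const (c * d) = const c * const d"
  and const_uminus: "const (- c) = - const c"
  and const_0: "const 0 = 0"
  and const_1: "const 1 = 1"
  by (simp_all add: const_def single_add mult_single single_uminus Zero_fract_def One_fract_def)

lemma const_eq_0_iff [simp]: "const c = 0 \<longleftrightarrow> c = 0"
proof -
  have "Poly_Mapping.single 0 c = (0 :: qpoly) \<longleftrightarrow> c = 0"
    by (metis lookup_single_eq lookup_zero single_zero)
  then show ?thesis by (simp add: const_def Zero_fract_def eq_fract)
qed

lemma const_of_nat: "const (of_nat k) = of_nat k"
  by (induction k) (simp_all add: const_0 const_1 const_add)

lemma const_inverse_of_nat_mult: "k > 0 \<Longrightarrow> const (inverse (of_nat k)) * of_nat k = 1"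
  by (simp flip: const_of_nat const_mult const_1)

lemma pd_add: "pd i (f + g) = pd i f + pd i g"
proof (cases f, cases g)
  fix p q r s assume f: "f = Fract p q" "q \<noteq> 0" and g: "g = Fract r s" "s \<noteq> 0"
  then show ?thesis
    by (simp add: pd_Fract poly_pd_add poly_pd_mult eq_fract algebra_simps)
qed

lemma pd_mult: "pd i (f * g) = pd i f * g + f * pd i g"
proof (cases f, cases g)
  fix p q r s assume f: "f = Fract p q" "q \<noteq> 0" and g: "g = Fract r s" "s \<noteq> 0"
  then show ?thesis
    by (simp add: pd_Fract poly_pd_add poly_pd_mult eq_fract algebra_simps)
qed

lemma pd_const [simp]: "pd i (const c) = 0"
proof -
  have "poly_pd i 1 = 0"
    using poly_pd_single[of i 0 1] by simp
  then show ?thesis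
    unfolding const_def by (subst pd_Fract) (simp_all add: poly_pd_single Zero_fract_def)
qed

lemma pd_1 [simp]: "pd i 1 = 0"
  using pd_const[of i 1] by (simp add: const_1)

lemma pd_0 [simp]: "pd i 0 = 0"
  using pd_const[of i 0] by (simp add: const_0)

lemma pd_uminus: "pd i (- f) = - pd i f"
  using pd_add[of i f "- f"] by (simp add: eq_neg_iff_add_eq_0 add.commute)

lemma pd_diff: "pd i (f - g) = pd i f - pd i g"
  using pd_add[of i f "- g"] by (simp add: pd_uminus)

lemma pd_tvar: "pd j (tvar i) = (if i = j then 1 else 0)"
proof -
  have "poly_pd j 1 = 0"
    using poly_pd_single[of j 0 1] by simp
  then show ?thesis
    unfolding tvar_def
    by (subst pd_Fract) (auto simp: poly_pd_single lookup_single Zero_fract_def One_fract_def)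
qed

lemma pd_inverse: "pd i (inverse f) = - pd i f * inverse f * inverse f"
proof (cases "f = 0")
  case False
  then have "0 = pd i (f * inverse f)" by simp
  also have "\<dots> = pd i f * inverse f + f * pd i (inverse f)" by (rule pd_mult)
  finally show ?thesis using False by (simp add: field_simps add_eq_0_iff)
qed simp

lemma pd_power: "pd i (f ^ k) = of_nat k * f ^ (k - 1) * pd i f"
proof (induction k)
  case (Suc k)
  then show ?case by (cases k) (simp_all add: pd_mult algebra_simps)
qed simp

text \<open>The derivations \<open>pd i\<close> separate the variables from each other and from the
  constants, so no comparison of the underlying polynomials is required.\<close>

lemma tvar_inject [simp]: "tvar i = tvar j \<longleftrightarrow> i = j"
  by (metis pd_tvar zero_neq_one)

lemma tvar_neq_const [simp]: "tvar i \<noteq> const c"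
  by (metis pd_tvar pd_const zero_neq_one)

lemma tvar_neq_0 [simp]: "tvar i \<noteq> 0" and tvar_neq_1 [simp]: "tvar i \<noteq> 1"
  using tvar_neq_const[of i 0] tvar_neq_const[of i 1] by (simp_all add: const_0 const_1)

section \<open>The coordinate rings as an iterated fibration\<close>

text \<open>Indexing by \<open>l = n - 3\<close> keeps natural number subtraction out of the induction.\<close>

definition regular :: "nat \<Rightarrow> ratfun set" where
  "regular l = coord_ring (l + 3)"

lemma regular_const: "const c \<in> regular l"
  and regular_tvar: "i \<in> {1..l} \<Longrightarrow> tvar i \<in> regular l"
  and regular_inverse_0: "i \<in> {1..l} \<Longrightarrow> inverse (tvar i) \<in> regular l"
  and regular_inverse_1: "i \<in> {1..l} \<Longrightarrow> inverse (tvar i - 1) \<in> regular l"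
  and regular_inverse_diff:
    "i \<in> {1..l} \<Longrightarrow> j \<in> {1..l} \<Longrightarrow> i \<noteq> j \<Longrightarrow> inverse (tvar i - tvar j) \<in> regular l"
  and regular_add: "f \<in> regular l \<Longrightarrow> g \<in> regular l \<Longrightarrow> f + g \<in> regular l"
  and regular_mult: "f \<in> regular l \<Longrightarrow> g \<in> regular l \<Longrightarrow> f * g \<in> regular l"
  unfolding regular_def by (rule coord_ring.intros; simp; fail)+

lemma regular_induct [consumes 1, case_names const tvar inverse_0 inverse_1 inverse_diff add mult]:
  assumes "f \<in> regular l"
    "\<And>c. P (const c)"
    "\<And>i. i \<in> {1..l} \<Longrightarrow> P (tvar i)"
    "\<And>i. i \<in> {1..l} \<Longrightarrow> P (inverse (tvar i))"
    "\<And>i. i \<in> {1..l} \<Longrightarrow> P (inverse (tvar i - 1))"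
    "\<And>i j. i \<in> {1..l} \<Longrightarrow> j \<in> {1..l} \<Longrightarrow> i \<noteq> j \<Longrightarrow> P (inverse (tvar i - tvar j))"
    "\<And>f g. f \<in> regular l \<Longrightarrow> P f \<Longrightarrow> g \<in> regular l \<Longrightarrow> P g \<Longrightarrow> P (f + g)"
    "\<And>f g. f \<in> regular l \<Longrightarrow> P f \<Longrightarrow> g \<in> regular l \<Longrightarrow> P g \<Longrightarrow> P (f * g)"
  shows "P f"
  using assms(1) unfolding regular_def
  by (induction rule: coord_ring.induct) (use assms(2-) in \<open>simp_all add: regular_def\<close>)

lemma regular_0: "0 \<in> regular l" and regular_1: "1 \<in> regular l"
  using regular_const[of 0 l] regular_const[of 1 l] by (simp_all add: const_0 const_1)

lemma regular_uminus: "f \<in> regular l \<Longrightarrow> - f \<in> regular l"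
  using regular_mult[OF regular_const[of "-1"]] by (simp add: const_uminus const_1)

lemma regular_diff: "f \<in> regular l \<Longrightarrow> g \<in> regular l \<Longrightarrow> f - g \<in> regular l"
  using regular_add[OF _ regular_uminus] by fastforce

lemma regular_power: "f \<in> regular l \<Longrightarrow> f ^ k \<in> regular l"
  by (induction k) (simp_all add: regular_1 regular_mult)

lemma regular_sum: "(\<And>x. x \<in> A \<Longrightarrow> f x \<in> regular l) \<Longrightarrow> sum f A \<in> regular l"
  by (induction A rule: infinite_finite_induct) (simp_all add: regular_0 regular_add)

lemma regular_pd: "f \<in> regular l \<Longrightarrow> pd i f \<in> regular l"
  by (induction rule: regular_induct)
    (auto simp: pd_add pd_mult pd_tvar pd_inverse pd_diff
      intro!: regular_0 regular_1 regular_add regular_mult regular_diff regular_uminus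
        regular_inverse_0 regular_inverse_1 regular_inverse_diff)

text \<open>No generator of \<open>regular l\<close> involves \<open>tvar i\<close>. The main use is
  \<open>i = Suc l\<close>: functions coming from the base are constants for the fibre
  derivative.\<close>

lemma pd_regular_eq_0: "f \<in> regular l \<Longrightarrow> l < i \<Longrightarrow> pd i f = 0"
  by (induction rule: regular_induct) (auto simp: pd_add pd_mult pd_tvar pd_inverse pd_diff)

lemma regular_mono: "f \<in> regular l \<Longrightarrow> l \<le> m \<Longrightarrow> f \<in> regular m"
  by (induction rule: regular_induct)
    (auto intro!: regular_const regular_tvar regular_inverse_0 regular_inverse_1
      regular_inverse_diff regular_add regular_mult)

text \<open>The punctures of the fibre of the projection forgetting \<open>t\<^bsub>l+1\<^esub>\<close>.\<close>

definition punctures :: "nat \<Rightarrow> ratfun set" where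
  "punctures l = {0, 1} \<union> tvar ` {1..l}"

lemma punctures_cases:
  assumes "b \<in> punctures l"
  obtains "b = 0" | "b = 1" | i where "i \<in> {1..l}" "b = tvar i"
  using assms by (auto simp: punctures_def)

lemma punctures_regular: "b \<in> punctures l \<Longrightarrow> b \<in> regular l"
  by (auto simp: punctures_def intro!: regular_0 regular_1 regular_tvar)

text \<open>Distinct punctures never collide over the base, so their differences are units there.
  This keeps the coefficients of partial fractions inside \<open>regular l\<close> instead of its
  fraction field.\<close>

lemma inverse_punctures_diff:
  assumes "a \<in> punctures l" "b \<in> punctures l"
  shows "inverse (a - b) \<in> regular l"
proof (cases "a = b")
  \<comment> \<open>Here \<open>inverse 0 = 0\<close>, which lies in the ring.\<close>
  case True then show ?thesis by (simp add: regular_0)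
next
  case False
  have neg: "inverse (1 - tvar i) = - inverse (tvar i - 1)" for i
    by (metis inverse_minus_eq minus_diff_eq)
  show ?thesis
    using assms(1,2) False
    by (elim punctures_cases)
      (auto simp: neg regular_1
        intro!: regular_uminus regular_inverse_0 regular_inverse_1 regular_inverse_diff)
qed

lemma tvar_notin_punctures: "b \<in> punctures l \<Longrightarrow> l < i \<Longrightarrow> tvar i \<noteq> b"
  by (auto simp: punctures_def)

lemma inverse_fibre_diff: "b \<in> punctures l \<Longrightarrow> inverse (tvar (Suc l) - b) \<in> regular (Suc l)"
  by (elim punctures_cases)
    (auto intro!: regular_inverse_0 regular_inverse_1 regular_inverse_diff)

section \<open>Partial fractions in the fibre coordinate\<close>

text \<open>Sums of terms, with no normal form imposed. The exponent \<open>Suc k\<close> keeps the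
  polar terms apart from the polynomial ones.\<close>

inductive_set partial_fractions :: "nat \<Rightarrow> ratfun set" for l where
  power: "f \<in> regular l \<Longrightarrow> f * tvar (Suc l) ^ k \<in> partial_fractions l"
| pole: "f \<in> regular l \<Longrightarrow> b \<in> punctures l \<Longrightarrow>
    f * inverse (tvar (Suc l) - b) ^ Suc k \<in> partial_fractions l"
| add: "f \<in> partial_fractions l \<Longrightarrow> g \<in> partial_fractions l \<Longrightarrow> f + g \<in> partial_fractions l"

lemma partial_fractions_mult_regular:
  "g \<in> partial_fractions l \<Longrightarrow> f \<in> regular l \<Longrightarrow> f * g \<in> partial_fractions l"
proof (induction rule: partial_fractions.induct)
  case (power g k)
  then show ?case
    using partial_fractions.power[OF regular_mult[OF power(2,1)]] by (simp add: mult.assoc)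
next
  case (pole g b k)
  then show ?case
    using partial_fractions.pole[OF regular_mult[OF pole(3,1)] pole(2)] by (simp add: mult.assoc)
next
  case (add g h)
  then show ?case by (simp add: distrib_left partial_fractions.add)
qed

lemma partial_fractions_diff:
  assumes "f \<in> partial_fractions l" "g \<in> partial_fractions l"
  shows "f - g \<in> partial_fractions l"
  using partial_fractions.add[OF assms(1)
      partial_fractions_mult_regular[OF assms(2) regular_const[of "-1"]]]
  by (simp add: const_uminus const_1)

lemma partial_fractions_mult_tvar:
  "g \<in> partial_fractions l \<Longrightarrow> tvar (Suc l) * g \<in> partial_fractions l"
proof (induction rule: partial_fractions.induct)
  case (power f k)
  then show ?case using partial_fractions.power[of f l "Suc k"] by (simp add: mult.left_commute)
next
  case (pole f b k)
  let ?u = "tvar (Suc l) - b"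
  have u: "?u \<noteq> 0" using tvar_notin_punctures[OF pole(2)] by simp
  have eq: "tvar (Suc l) * (f * inverse ?u ^ Suc k) =
      f * inverse ?u ^ k + (b * f) * inverse ?u ^ Suc k"
  proof -
    have "tvar (Suc l) * inverse ?u = 1 + b * inverse ?u"
      using u by (simp add: field_simps)
    then have "f * inverse ?u ^ k * (tvar (Suc l) * inverse ?u) =
        f * inverse ?u ^ k * (1 + b * inverse ?u)" by simp
    then show ?thesis by (simp add: algebra_simps)
  qed
  \<comment> \<open>One order of the pole has been cancelled: for \<open>k = 0\<close> a polynomial
    term is left, otherwise a pole of order k.\<close>
  have "f * inverse ?u ^ k \<in> partial_fractions l"
    using partial_fractions.power[OF pole(1), of 0] partial_fractions.pole[OF pole(1,2)]
    by (cases k) simp_all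
  moreover have "(b * f) * inverse ?u ^ Suc k \<in> partial_fractions l"
    using pole by (intro partial_fractions.pole regular_mult) (auto intro: punctures_regular)
  ultimately show ?case unfolding eq by (rule partial_fractions.add)
next
  case (add f g)
  then show ?case by (simp add: distrib_left partial_fractions.add)
qed

text \<open>With u = t - a and v = t - b, two different poles are separated by 1/(u v) = (1/u -
  1/v)/(a - b), which lowers the order at b by one each time it is applied. Against a power of t,
  the identity t/u = 1 + a/u lowers the degree.\<close>

lemma partial_fractions_mult_inverse:
  assumes a: "a \<in> punctures l"
  shows "g \<in> partial_fractions l \<Longrightarrow> inverse (tvar (Suc l) - a) * g \<in> partial_fractions l"
proof (induction rule: partial_fractions.induct)
  case (power f k)
  let ?u = "tvar (Suc l) - a"
  have u: "?u \<noteq> 0" using tvar_notin_punctures[OF a] by simp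
  show ?case
  proof (induction k)
    case 0
    then show ?case using partial_fractions.pole[OF power a, of 0] by (simp add: mult.commute)
  next
    case (Suc k)
    have "tvar (Suc l) * inverse ?u = 1 + a * inverse ?u"
      using u by (simp add: field_simps)
    then have "f * tvar (Suc l) ^ k * (tvar (Suc l) * inverse ?u) =
        f * tvar (Suc l) ^ k * (1 + a * inverse ?u)" by simp
    then have "inverse ?u * (f * tvar (Suc l) ^ Suc k) =
        f * tvar (Suc l) ^ k + a * (inverse ?u * (f * tvar (Suc l) ^ k))"
      by (simp add: algebra_simps)
    then show ?case
      using Suc partial_fractions.power[OF power, of k] punctures_regular[OF a]
      by (simp only: partial_fractions.add partial_fractions_mult_regular)
  qed
next
  case (pole f b k)
  let ?u = "tvar (Suc l) - a" and ?v = "tvar (Suc l) - b"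
  have u: "?u \<noteq> 0" and v: "?v \<noteq> 0"
    using tvar_notin_punctures[OF a] tvar_notin_punctures[OF pole(2)] by simp_all
  have f: "f \<in> partial_fractions l"
    using partial_fractions.power[OF pole(1), of 0] by simp
  show ?case
  proof (cases "a = b")
    case True
    then show ?thesis
      using partial_fractions.pole[OF pole(1,2), of "Suc k"] by (simp add: ac_simps)
  next
    case False
    have split: "inverse ?u * inverse ?v = inverse (a - b) * (inverse ?u - inverse ?v)"
      using u v False by (simp add: field_simps)
    show ?thesis
    proof (induction k)
      case 0
      have "inverse ?u * (f * inverse ?v ^ Suc 0) = inverse (a - b) *
          (f * inverse ?u ^ Suc 0 - f * inverse ?v ^ Suc 0)"
        using arg_cong[OF split, of "(*) f"] by (simp add: algebra_simps)
      also have "\<dots> \<in> partial_fractions l"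
        by (intro partial_fractions_mult_regular partial_fractions_diff partial_fractions.pole
            inverse_punctures_diff pole a)
      finally show ?case .
    next
      case (Suc k)
      have "inverse ?u * (f * inverse ?v ^ Suc (Suc k)) = inverse (a - b) *
          (inverse ?u * (f * inverse ?v ^ Suc k) - f * inverse ?v ^ Suc (Suc k))"
        using arg_cong[OF split, of "(*) (f * inverse ?v ^ Suc k)"] by (simp add: algebra_simps)
      also have "\<dots> \<in> partial_fractions l"
        by (intro partial_fractions_mult_regular partial_fractions_diff partial_fractions.pole
            inverse_punctures_diff pole a Suc)
      finally show ?case .
    qed
  qed
next
  case (add f g)
  then show ?case by (simp add: distrib_left partial_fractions.add)
qed

text \<open>Letting f act on an arbitrary \<open>g\<close> makes the product case of the induction a
  mere composition; a direct induction for membership would require closure of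
  \<open>partial_fractions l\<close> under products.\<close>

lemma regular_Suc_mult_partial_fractions:
  assumes "f \<in> regular (Suc l)"
  shows "g \<in> partial_fractions l \<Longrightarrow> f * g \<in> partial_fractions l"
  using assms
proof (induction arbitrary: g rule: regular_induct)
  case (const c)
  then show ?case by (intro partial_fractions_mult_regular regular_const)
next
  case (tvar i)
  then show ?case
    by (cases "i = Suc l")
      (auto intro!: partial_fractions_mult_tvar partial_fractions_mult_regular regular_tvar)
next
  case (inverse_0 i)
  then show ?case
    using partial_fractions_mult_inverse[of 0 l g]
    by (cases "i = Suc l")
      (auto simp: punctures_def intro!: partial_fractions_mult_regular regular_inverse_0)
next
  case (inverse_1 i)
  then show ?case
    using partial_fractions_mult_inverse[of 1 l g]
    by (cases "i = Suc l")
      (auto simp: punctures_def intro!: partial_fractions_mult_regular regular_inverse_1)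
next
  case (inverse_diff i j)
  have neg: "inverse (tvar i - tvar j) * g = 0 - inverse (tvar j - tvar i) * g"
    by (metis diff_0 inverse_minus_eq minus_diff_eq mult_minus_left)
  have zero: "0 \<in> partial_fractions l"
    using partial_fractions.power[OF regular_0] by simp
  consider "i = Suc l" "j \<in> {1..l}" | "j = Suc l" "i \<in> {1..l}" | "i \<in> {1..l}" "j \<in> {1..l}"
    using inverse_diff(1-3) by force
  then show ?case
  proof cases
    case 1
    then show ?thesis
      using inverse_diff(4) by (auto intro!: partial_fractions_mult_inverse simp: punctures_def)
  next
    case 2
    then have "inverse (tvar j - tvar i) * g \<in> partial_fractions l"
      using inverse_diff(4) by (auto intro!: partial_fractions_mult_inverse simp: punctures_def)
    from partial_fractions_diff[OF zero this] show ?thesis unfolding neg by simp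
  next
    case 3
    then show ?thesis
      using inverse_diff by (intro partial_fractions_mult_regular regular_inverse_diff) auto
  qed
next
  case (add f g)
  then show ?case by (simp add: distrib_right partial_fractions.add)
next
  case (mult f g)
  then show ?case by (simp add: mult.assoc)
qed

lemma regular_Suc_partial_fractions: "f \<in> regular (Suc l) \<Longrightarrow> f \<in> partial_fractions l"
  using regular_Suc_mult_partial_fractions[of f l 1] partial_fractions.power[OF regular_1, of l 0]
  by simp

section \<open>Laurent expansion along the fibre\<close>

definition monomial_value :: "(nat \<Rightarrow> 'a) \<Rightarrow> (nat \<Rightarrow>\<^sub>0 nat) \<Rightarrow> 'a::comm_monoid_mult" where
  "monomial_value v m = (\<Prod>i\<in>Poly_Mapping.keys m. v i ^ Poly_Mapping.lookup m i)"

lemma monomial_value_superset: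
  assumes "finite A" "Poly_Mapping.keys m \<subseteq> A"
  shows "monomial_value v m = (\<Prod>i\<in>A. v i ^ Poly_Mapping.lookup m i)"
  unfolding monomial_value_def
  by (rule prod.mono_neutral_left) (use assms in \<open>auto simp: in_keys_iff\<close>)

lemma monomial_value_add: "monomial_value v (m + k) = monomial_value v m * monomial_value v k"
proof -
  let ?A = "Poly_Mapping.keys m \<union> Poly_Mapping.keys k"
  have "Poly_Mapping.keys (m + k) \<subseteq> ?A" by (rule Poly_Mapping.keys_add)
  then show ?thesis
    by (subst (1 2 3) monomial_value_superset[of ?A]) (auto simp: lookup_add power_add prod.distrib)
qed

lemma monomial_value_0 [simp]: "monomial_value v 0 = 1"
  by (simp add: monomial_value_def)

lemma monomial_value_single_1 [simp]: "monomial_value v (Poly_Mapping.single i 1) = v i"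
  by (simp add: monomial_value_def)

text \<open>The substitution t_l = a + X, where X is the local parameter t_l - a and all other
  variables count as scalars. The coefficients live in the full field \<open>ratfun\<close>, so no
  separate function field of the base has to be built.\<close>

definition fibre_poly :: "nat \<Rightarrow> ratfun \<Rightarrow> qpoly \<Rightarrow> ratfun poly" where
  "fibre_poly l a p = (\<Sum>m\<in>Poly_Mapping.keys p. [:const (Poly_Mapping.lookup p m):] *
     monomial_value (\<lambda>i. if i = l then [:a, 1:] else [:tvar i:]) m)"

lemma fibre_poly_superset:
  assumes "finite A" "Poly_Mapping.keys p \<subseteq> A"
  shows "fibre_poly l a p = (\<Sum>m\<in>A. [:const (Poly_Mapping.lookup p m):] *
     monomial_value (\<lambda>i. if i = l then [:a, 1:] else [:tvar i:]) m)"
  unfolding fibre_poly_def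
  by (rule sum.mono_neutral_left) (use assms in \<open>auto simp: in_keys_iff const_0\<close>)

lemma fibre_poly_add: "fibre_poly l a (p + q) = fibre_poly l a p + fibre_poly l a q"
proof -
  let ?A = "Poly_Mapping.keys p \<union> Poly_Mapping.keys q"
  have pc: "[:c + d:] = [:c:] + [:d:]" for c d :: ratfun by simp
  have "Poly_Mapping.keys (p + q) \<subseteq> ?A" by (rule Poly_Mapping.keys_add)
  then show ?thesis
    by (subst (1 2 3) fibre_poly_superset[of ?A])
      (auto simp: lookup_add const_add pc distrib_right sum.distrib simp del: add_pCons)
qed

lemma fibre_poly_0 [simp]: "fibre_poly l a 0 = 0"
  by (simp add: fibre_poly_def)

lemma fibre_poly_sum: "fibre_poly l a (sum f A) = (\<Sum>x\<in>A. fibre_poly l a (f x))"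
  by (induction A rule: infinite_finite_induct) (auto simp: fibre_poly_add)

lemma fibre_poly_single:
  "fibre_poly l a (Poly_Mapping.single m c) =
    [:const c:] * monomial_value (\<lambda>i. if i = l then [:a, 1:] else [:tvar i:]) m"
  by (subst fibre_poly_superset[of "{m}"]) auto

lemma qpoly_decomp:
  "p = (\<Sum>m\<in>Poly_Mapping.keys p. Poly_Mapping.single m (Poly_Mapping.lookup p m))" for p :: qpoly
  by (rule poly_mapping_eqI) (auto simp: lookup_sum lookup_single when_def in_keys_iff)

lemma fibre_poly_mult: "fibre_poly l a (p * q) = fibre_poly l a p * fibre_poly l a q"
proof -
  have pc: "[:c * d:] = [:c:] * [:d:]" for c d :: ratfun by simp
  have single: "fibre_poly l a (Poly_Mapping.single m c * Poly_Mapping.single k d) =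
      fibre_poly l a (Poly_Mapping.single m c) * fibre_poly l a (Poly_Mapping.single k d)" for m k c d
    by (simp only: mult_single fibre_poly_single monomial_value_add const_mult pc) (simp only: ac_simps)
  have 1: "fibre_poly l a (Poly_Mapping.single m c * q) =
      fibre_poly l a (Poly_Mapping.single m c) * fibre_poly l a q" for m c
    by (subst (1 2) qpoly_decomp[of q]) (simp only: fibre_poly_sum sum_distrib_left single)
  show ?thesis
    by (subst (1 2) qpoly_decomp[of p]) (simp only: fibre_poly_sum sum_distrib_right 1)
qed

lemma Fract_single:
  "Fract (Poly_Mapping.single m c) 1 = const c * monomial_value tvar m"
proof -
  have Fp: "Fract (p * q) 1 = Fract p 1 * Fract q 1" for p q :: qpoly by simp
  have F1: "Fract (1::qpoly) 1 = 1" by (simp add: One_fract_def)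
  have pow: "Fract (Poly_Mapping.single (Poly_Mapping.single i k) 1) 1 = tvar i ^ k" for i k
  proof (induction k)
    case 0 then show ?case by (simp add: F1)
  next
    case (Suc k)
    have "Poly_Mapping.single (Poly_Mapping.single i (Suc k)) (1::rat) =
       Poly_Mapping.single (Poly_Mapping.single i 1) 1 * Poly_Mapping.single (Poly_Mapping.single i k) 1"
      by (simp add: mult_single flip: single_add)
    then show ?case using Suc by (simp only: Fp tvar_def power_Suc)
  qed
  have fin: "Fract (Poly_Mapping.single (\<Sum>i\<in>A. Poly_Mapping.single i (e i)) (1::rat)) 1 =
      (\<Prod>i\<in>A. tvar i ^ e i)" if "finite A" for A and e :: "nat \<Rightarrow> nat"
    using that
  proof (induction A rule: finite_induct)
    case empty then show ?case by (simp add: F1)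
  next
    case (insert x A)
    have "Poly_Mapping.single (\<Sum>i\<in>insert x A. Poly_Mapping.single i (e i)) (1::rat) =
        Poly_Mapping.single (Poly_Mapping.single x (e x)) 1 *
        Poly_Mapping.single (\<Sum>i\<in>A. Poly_Mapping.single i (e i)) 1"
      using insert by (simp add: mult_single)
    then show ?case using insert by (simp only: Fp pow) simp
  qed
  have "m = (\<Sum>i\<in>Poly_Mapping.keys m. Poly_Mapping.single i (Poly_Mapping.lookup m i))"
    by (rule poly_mapping_eqI) (auto simp: lookup_sum lookup_single when_def in_keys_iff)
  then have "Fract (Poly_Mapping.single m (1::rat)) 1 = monomial_value tvar m"
    using fin[of "Poly_Mapping.keys m" "Poly_Mapping.lookup m"] by (simp add: monomial_value_def)
  moreover have "Poly_Mapping.single m c = Poly_Mapping.single 0 c * Poly_Mapping.single m 1"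
    by (simp add: mult_single)
  ultimately show ?thesis by (simp only: Fp const_def)
qed

lemma Fract_sum: "Fract (sum f A) (1::qpoly) = (\<Sum>x\<in>A. Fract (f x) 1)"
proof -
  have "Fract (p + q) 1 = Fract p 1 + Fract q 1" for p q :: qpoly by simp
  then show ?thesis
    by (induction A rule: infinite_finite_induct)
      (simp_all add: Zero_fract_def eq_fract del: add_fract)
qed

lemma poly_monomial_value:
  "poly (monomial_value v m) x = monomial_value (\<lambda>i. poly (v i) x) m" for x :: ratfun
  by (simp add: monomial_value_def poly_prod)

text \<open>Evaluating at \<open>X = t\<^sub>l - a\<close> undoes the substitution; hence the substitution is injective.\<close>

lemma poly_fibre_poly: "poly (fibre_poly l a p) (tvar l - a) = Fract p 1"
proof -
  have v: "poly (if i = l then [:a, 1:] else [:tvar i:]) (tvar l - a) = tvar i" for i by simp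
  have "Fract p 1 = (\<Sum>m\<in>Poly_Mapping.keys p. const (Poly_Mapping.lookup p m) * monomial_value tvar m)"
    by (subst qpoly_decomp[of p]) (simp only: Fract_sum Fract_single)
  then show ?thesis
    by (simp add: fibre_poly_def poly_sum poly_monomial_value v)
qed

lemma fibre_poly_eq_0_iff: "fibre_poly l a p = 0 \<longleftrightarrow> p = 0"
proof
  assume "fibre_poly l a p = 0"
  then have "Fract p 1 = 0" using poly_fibre_poly[of l a p] by simp
  then show "p = 0" by (simp add: Zero_fract_def eq_fract)
qed simp

definition poly_fls :: "ratfun poly \<Rightarrow> ratfun fls" where
  "poly_fls p = fps_to_fls (fps_of_poly p)"

lemma poly_fls_simps:
  "poly_fls (p + q) = poly_fls p + poly_fls q"
  "poly_fls (p * q) = poly_fls p * poly_fls q"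
  "poly_fls 1 = 1"
  "poly_fls p = 0 \<longleftrightarrow> p = 0"
  using fps_of_poly_eq_iff[of p 0]
  by (simp_all add: poly_fls_def fps_of_poly_add fps_of_poly_mult fls_times_fps_to_fls)

text \<open>The Laurent expansion along t_l = a. Since the substitution is injective, nonzero
  denominators stay nonzero and it extends to fractions; \<open>expansion_Fract\<close> shows that
  the result does not depend on the representation chosen by \<open>SOME\<close>.\<close>

definition expansion :: "nat \<Rightarrow> ratfun \<Rightarrow> ratfun \<Rightarrow> ratfun fls" where
  "expansion l a f = (SOME g. \<exists>p q. q \<noteq> 0 \<and> f = Fract p q \<and>
     g = poly_fls (fibre_poly l a p) / poly_fls (fibre_poly l a q))"

lemma expansion_Fract:
  assumes "q \<noteq> 0"
  shows "expansion l a (Fract p q) = poly_fls (fibre_poly l a p) / poly_fls (fibre_poly l a q)"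
proof -
  let ?P = "\<lambda>p. poly_fls (fibre_poly l a p)"
  have "\<exists>g p' q'. q' \<noteq> 0 \<and> Fract p q = Fract p' q' \<and> g = ?P p' / ?P q'"
    using assms by blast
  from someI_ex[OF this] obtain p' q' where q': "q' \<noteq> 0" "Fract p q = Fract p' q'"
      "expansion l a (Fract p q) = ?P p' / ?P q'"
    unfolding expansion_def by blast
  have "p * q' = p' * q" using q' assms by (simp add: eq_fract)
  then have "?P p * ?P q' = ?P p' * ?P q"
    by (simp flip: poly_fls_simps fibre_poly_mult)
  then show ?thesis
    using q' assms by (simp add: frac_eq_eq poly_fls_simps fibre_poly_eq_0_iff)
qed

lemma expansion_add: "expansion l a (f + g) = expansion l a f + expansion l a g"
proof (cases f, cases g)
  fix p q r s assume f: "f = Fract p q" "q \<noteq> 0" and g: "g = Fract r s" "s \<noteq> 0"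
  have "f + g = Fract (p * s + r * q) (q * s)" using f g by simp
  then show ?thesis
    using f g
    by (simp add: expansion_Fract fibre_poly_add fibre_poly_mult poly_fls_simps
        fibre_poly_eq_0_iff add_frac_eq del: add_fract)
qed

lemma expansion_mult: "expansion l a (f * g) = expansion l a f * expansion l a g"
proof (cases f, cases g)
  fix p q r s assume f: "f = Fract p q" "q \<noteq> 0" and g: "g = Fract r s" "s \<noteq> 0"
  have "f * g = Fract (p * r) (q * s)" using f g by simp
  then show ?thesis
    using f g by (simp add: expansion_Fract fibre_poly_mult poly_fls_simps del: mult_fract)
qed

lemma fibre_poly_1: "fibre_poly l a 1 = 1"
  using fibre_poly_single[of l a 0 1] by (simp add: const_1 one_pCons)

lemma poly_fls_const: "poly_fls [:c:] = fls_const c"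
  by (simp add: poly_fls_def fps_of_poly_const)

lemma expansion_const: "expansion l a (const c) = fls_const (const c)"
proof -
  have "expansion l a (Fract (Poly_Mapping.single 0 c) 1) = fls_const (const c)"
    by (subst expansion_Fract)
      (simp_all add: fibre_poly_single fibre_poly_1 poly_fls_simps poly_fls_const)
  then show ?thesis by (simp only: const_def)
qed

lemma expansion_tvar:
  "expansion l a (tvar i) = (if i = l then fls_const a + fls_X else fls_const (tvar i))"
proof -
  have X: "poly_fls [:a, 1:] = fls_const a + fls_X"
    by (simp add: poly_fls_def fps_of_poly_linear fps_X_to_fls)
  have "fibre_poly l a (Poly_Mapping.single (Poly_Mapping.single i 1) 1) =
      (if i = l then [:a, 1:] else [:tvar i:])"
    by (simp only: fibre_poly_single monomial_value_single_1 const_1) simp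
  then have "expansion l a (Fract (Poly_Mapping.single (Poly_Mapping.single i 1) 1) 1) =
      poly_fls (if i = l then [:a, 1:] else [:tvar i:])"
    by (subst expansion_Fract)
      (simp_all only: fibre_poly_1 poly_fls_simps(3) div_by_1 one_neq_zero not_False_eq_True)
  then show ?thesis by (simp only: tvar_def[symmetric]) (simp add: X poly_fls_const)
qed

lemma expansion_1: "expansion l a 1 = 1"
  using expansion_const[of l a 1] by (simp add: const_1)

lemma expansion_0: "expansion l a 0 = 0"
  using expansion_const[of l a 0] by (simp add: const_0)

lemma expansion_uminus: "expansion l a (- f) = - expansion l a f"
  using expansion_add[of l a f "- f"] by (simp add: expansion_0 eq_neg_iff_add_eq_0 add.commute)

lemma expansion_diff: "expansion l a (f - g) = expansion l a f - expansion l a g"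
  using expansion_add[of l a f "- g"] by (simp add: expansion_uminus)

lemma expansion_inverse: "expansion l a (inverse f) = inverse (expansion l a f)"
proof (cases "f = 0")
  case False
  then have "expansion l a f * expansion l a (inverse f) = 1"
    by (simp add: expansion_1 flip: expansion_mult)
  then show ?thesis by (metis inverse_unique)
qed (simp add: expansion_0)

lemma expansion_power: "expansion l a (f ^ k) = expansion l a f ^ k"
  by (induction k) (simp_all add: expansion_1 expansion_mult)

text \<open>The substitution touches only \<open>tvar (Suc l)\<close>, which no function of the base
  contains. This makes the residue linear over the base ring.\<close>

lemma expansion_regular: "f \<in> regular l \<Longrightarrow> expansion (Suc l) a f = fls_const f"
proof (induction rule: regular_induct)
  case (inverse_diff i j)
  then show ?case
    by (simp add: expansion_inverse expansion_diff expansion_tvar fls_minus_const fls_inverse_const)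
next
  case (inverse_1 i)
  have "fls_const (tvar i) - 1 = fls_const (tvar i - 1)"
    using fls_minus_const[of "tvar i" 1] by simp
  then show ?case
    using inverse_1
    by (simp add: expansion_inverse expansion_diff expansion_tvar expansion_1 fls_inverse_const)
qed (simp_all add: expansion_const expansion_tvar expansion_inverse expansion_add expansion_mult
      fls_inverse_const fls_plus_const)

section \<open>Residues along the punctures\<close>

definition fibre_residue :: "nat \<Rightarrow> ratfun \<Rightarrow> ratfun \<Rightarrow> ratfun" where
  "fibre_residue l b f = fls_residue (expansion (Suc l) b f)"

lemma fibre_residue_add: "fibre_residue l b (f + g) = fibre_residue l b f + fibre_residue l b g"
  by (simp add: fibre_residue_def expansion_add)

lemma fibre_residue_mult_regular:
  "f \<in> regular l \<Longrightarrow> fibre_residue l b (f * g) = f * fibre_residue l b g"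
  unfolding fibre_residue_def expansion_mult
  by (simp only: expansion_regular fls_residue_fls_const_times)

lemma fibre_residue_0 [simp]: "fibre_residue l b 0 = 0"
  by (simp add: fibre_residue_def expansion_0)

lemma fibre_residue_sum: "fibre_residue l b (sum f A) = (\<Sum>x\<in>A. fibre_residue l b (f x))"
  by (induction A rule: infinite_finite_induct) (simp_all add: fibre_residue_add)

lemma fibre_residue_const_mult: "fibre_residue l b (const c * f) = const c * fibre_residue l b f"
  by (rule fibre_residue_mult_regular) (rule regular_const)

lemma fibre_residue_power: "fibre_residue l b (tvar (Suc l) ^ k) = 0"
proof -
  have "fls_const b + fls_X = fps_to_fls (fps_const b + fps_X)"
    by (simp add: fps_X_to_fls)
  then have "expansion (Suc l) b (tvar (Suc l) ^ k) = fps_to_fls ((fps_const b + fps_X) ^ k)"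
    by (simp add: expansion_power expansion_tvar fps_to_fls_power)
  then show ?thesis by (simp add: fibre_residue_def)
qed

text \<open>At its own puncture the function expands to X^(-k-1). At any other one the constant term
  b - c of the base is invertible, so the expansion is a power series.\<close>

lemma fibre_residue_pole:
  assumes "b \<in> punctures l" "c \<in> punctures l"
  shows "fibre_residue l b (inverse (tvar (Suc l) - c) ^ Suc k) = (if b = c \<and> k = 0 then 1 else 0)"
proof -
  have "expansion (Suc l) b (tvar (Suc l) - c) = fls_const (b - c) + fls_X"
    using assms by (simp add: expansion_diff expansion_tvar expansion_regular[OF punctures_regular]
        flip: fls_minus_const)
  then have e: "expansion (Suc l) b (inverse (tvar (Suc l) - c) ^ Suc k) =
      inverse (fls_const (b - c) + fls_X) ^ Suc k"
    by (simp only: expansion_power expansion_inverse)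
  show ?thesis
  proof (cases "b = c")
    case True
    then have "expansion (Suc l) b (inverse (tvar (Suc l) - c) ^ Suc k) = fls_X_inv ^ Suc k"
      unfolding e by (simp add: fls_inverse_X)
    moreover have "fls_nth (fls_X_inv ^ Suc k :: ratfun fls) (- 1) = (if k = 0 then 1 else 0)"
      by (subst fls_X_inv_power_nth) auto
    ultimately show ?thesis
      using True by (simp only: fibre_residue_def fls_residue_def) simp
  next
    case False
    let ?s = "fps_const (b - c) + fps_X"
    have "?s $ 0 \<noteq> 0" using False by simp
    then have "inverse (fps_to_fls ?s) = fps_to_fls (inverse ?s)"
      by (intro fls_inverse_fps_to_fls) (simp add: subdegree_eq_0_iff)
    moreover have "fls_const (b - c) + fls_X = fps_to_fls ?s"
      by (simp add: fps_X_to_fls)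
    ultimately have "expansion (Suc l) b (inverse (tvar (Suc l) - c) ^ Suc k) =
        fps_to_fls (inverse ?s ^ Suc k)"
      unfolding e by (simp only: fps_to_fls_power)
    then show ?thesis using False by (simp add: fibre_residue_def)
  qed
qed

text \<open>The factor \<open>pd j c - (if j = Suc l then 1 else 0)\<close> is minus the derivative
  of t - c. The form is chosen so that the second summand visibly has a pole of order at least two,
  hence no residue.\<close>

lemma pd_fibre_pole:
  assumes "f \<in> regular l" "c \<in> punctures l"
  shows "pd j (f * inverse (tvar (Suc l) - c) ^ Suc k) =
    pd j f * inverse (tvar (Suc l) - c) ^ Suc k +
    (const (of_nat (Suc k)) * f * (pd j c - (if j = Suc l then 1 else 0))) *
      inverse (tvar (Suc l) - c) ^ Suc (Suc k)"
proof -
  let ?u = "inverse (tvar (Suc l) - c)"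
  define d :: ratfun where "d = of_nat (Suc k)"
  have "pd j (?u ^ Suc k) = d * ?u ^ k * pd j ?u"
    by (subst pd_power) (simp only: d_def diff_Suc_1)
  moreover have "pd j ?u = (pd j c - (if j = Suc l then 1 else 0)) * ?u * ?u"
    by (simp add: pd_inverse pd_diff pd_tvar)
  ultimately show ?thesis
    unfolding const_of_nat d_def[symmetric] by (simp only: pd_mult) (simp add: ac_simps)
qed

text \<open>Both claims are checked on partial fractions. The residue collects coefficients of 1/(t
  - b), which lie in \<open>regular l\<close>. Differentiating a pole gives the derivative of its
  coefficient plus a pole of order at least two, which the residue does not see; for
  \<open>j = Suc l\<close> the coefficient is constant and nothing is left.\<close>

lemma fibre_residue_regular_pd:
  assumes "b \<in> punctures l" "f \<in> regular (Suc l)"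
  shows fibre_residue_regular: "fibre_residue l b f \<in> regular l"
    and fibre_residue_pd: "fibre_residue l b (pd j f) =
      (if j = Suc l then 0 else pd j (fibre_residue l b f))"
proof -
  have "f \<in> partial_fractions l"
    using assms by (intro regular_Suc_partial_fractions)
  then have "fibre_residue l b f \<in> regular l \<and>
      fibre_residue l b (pd j f) = (if j = Suc l then 0 else pd j (fibre_residue l b f))"
  proof (induction rule: partial_fractions.induct)
    case (power f k)
    have "pd j (f * tvar (Suc l) ^ k) = pd j f * tvar (Suc l) ^ k +
        (const (of_nat k) * (if j = Suc l then 1 else 0) * f) * tvar (Suc l) ^ (k - 1)"
      by (auto simp: pd_mult pd_power pd_tvar const_of_nat algebra_simps)
    moreover have "const (of_nat k) * (if j = Suc l then 1 else 0) * f \<in> regular l"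
      using power by (auto intro!: regular_mult regular_const regular_0)
    ultimately show ?case
      using power
      by (simp add: fibre_residue_add fibre_residue_mult_regular regular_pd fibre_residue_power regular_0)
  next
    case (pole f c k)
    define C where "C = const (of_nat (Suc k)) * f * (pd j c - (if j = Suc l then 1 else 0))"
    have r: "C \<in> regular l"
      unfolding C_def using pole punctures_regular[OF pole(2)]
      by (auto intro!: regular_mult regular_const regular_diff regular_0 regular_1 regular_pd)
    have "pd j f = 0" if "j = Suc l"
      using pd_regular_eq_0[OF pole(1), of j] that by simp
    moreover define P where "P k = inverse (tvar (Suc l) - c) ^ Suc k" for k
    moreover have "fibre_residue l b (P k) = (if b = c \<and> k = 0 then 1 else 0)" for k
      unfolding P_def by (rule fibre_residue_pole) fact+
    ultimately show ?case
      using pole(1,2) unfolding pd_fibre_pole[OF pole(1,2)] unfolding P_def[symmetric] C_def[symmetric]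
      by (auto simp: fibre_residue_add fibre_residue_mult_regular regular_pd r regular_0)
  next
    case (add f g)
    then show ?case by (auto simp: pd_add fibre_residue_add regular_add)
  qed
  then show "fibre_residue l b f \<in> regular l"
    and "fibre_residue l b (pd j f) = (if j = Suc l then 0 else pd j (fibre_residue l b f))"
    by simp_all
qed

section \<open>Exact functions\<close>

text \<open>Divergences of regular vector fields. These are the coefficients of exact top forms; the
  alternating signs of d are absorbed into the \<open>h j\<close> (see
  \<open>exact_forms_top\<close>).\<close>

definition exact_functions :: "nat \<Rightarrow> ratfun set" where
  "exact_functions l = {\<Sum>j\<in>{1..l}. pd j (h j) |h. \<forall>j. h j \<in> regular l}"

lemma exact_functionsI: "(\<And>j. h j \<in> regular l) \<Longrightarrow> (\<Sum>j\<in>{1..l}. pd j (h j)) \<in> exact_functions l"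
  by (auto simp: exact_functions_def)

lemma exact_functions_0: "0 \<in> exact_functions l"
  using exact_functionsI[of "\<lambda>_. 0" l] by (simp add: regular_0)

lemma exact_functions_add:
  assumes "f \<in> exact_functions l" "g \<in> exact_functions l"
  shows "f + g \<in> exact_functions l"
proof -
  from assms obtain h k where "f = (\<Sum>j\<in>{1..l}. pd j (h j))" "g = (\<Sum>j\<in>{1..l}. pd j (k j))"
      "\<And>j. h j \<in> regular l" "\<And>j. k j \<in> regular l"
    by (auto simp: exact_functions_def)
  then show ?thesis
    using exact_functionsI[of "\<lambda>j. h j + k j" l] by (simp add: pd_add sum.distrib regular_add)
qed

lemma exact_functions_const_mult:
  assumes "f \<in> exact_functions l"
  shows "const c * f \<in> exact_functions l"
proof -
  from assms obtain h where "f = (\<Sum>j\<in>{1..l}. pd j (h j))" "\<And>j. h j \<in> regular l"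
    by (auto simp: exact_functions_def)
  then show ?thesis
    using exact_functionsI[of "\<lambda>j. const c * h j" l]
    by (simp add: pd_mult sum_distrib_left regular_mult regular_const)
qed

lemma exact_functions_uminus: "f \<in> exact_functions l \<Longrightarrow> - f \<in> exact_functions l"
  using exact_functions_const_mult[of f l "-1"] by (simp add: const_uminus const_1)

lemma exact_functions_sum:
  "(\<And>x. x \<in> A \<Longrightarrow> f x \<in> exact_functions l) \<Longrightarrow> sum f A \<in> exact_functions l"
  by (induction A rule: infinite_finite_induct) (auto simp: exact_functions_0 exact_functions_add)

lemma exact_functions_pd:
  assumes "f \<in> regular l" "j \<in> {1..l}"
  shows "pd j f \<in> exact_functions l"
proof -
  have "(\<Sum>i\<in>{1..l}. pd i (if i = j then f else 0)) = (\<Sum>i\<in>{1..l}. if i = j then pd j f else 0)"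
    by (intro sum.cong) auto
  then have "(\<Sum>i\<in>{1..l}. pd i (if i = j then f else 0)) = pd j f"
    using assms by simp
  then show ?thesis
    using exact_functionsI[of "\<lambda>i. if i = j then f else 0" l] assms by (simp add: regular_0)
qed

lemma exact_functions_regular: "f \<in> exact_functions l \<Longrightarrow> f \<in> regular l"
  by (auto simp: exact_functions_def intro!: regular_sum regular_pd)

lemma exact_functions_0_dim: "exact_functions 0 = {0}"
  by (auto simp: exact_functions_def intro: exI[of _ "\<lambda>_. 0"] regular_0)

lemma fibre_residue_exact:
  assumes "b \<in> punctures l" "f \<in> exact_functions (Suc l)"
  shows "fibre_residue l b f \<in> exact_functions l"
proof -
  from assms obtain h where f: "f = (\<Sum>j\<in>{1..Suc l}. pd j (h j))" and h: "\<And>j. h j \<in> regular (Suc l)"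
    by (auto simp: exact_functions_def)
  \<comment> \<open>The summand of the fibre derivative has residue 0, which leaves a sum over the
    base coordinates.\<close>
  have "fibre_residue l b f = (\<Sum>j\<in>{1..l}. pd j (fibre_residue l b (h j)))"
    using assms(1) h by (simp add: f fibre_residue_sum fibre_residue_pd fibre_residue_add)
  then show ?thesis
    using exact_functionsI[of "\<lambda>j. fibre_residue l b (h j)"] fibre_residue_regular[OF assms(1) h]
    by simp
qed

text \<open>If \<open>b = t\<^sub>j\<close>, differentiating the pole with respect to \<open>t\<^sub>j\<close> produces a double pole, which is
  itself a derivative with respect to the fibre coordinate.\<close>

lemma exact_mult_simple_pole:
  assumes "f \<in> exact_functions l" "b \<in> punctures l"
  shows "f * inverse (tvar (Suc l) - b) \<in> exact_functions (Suc l)"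
proof -
  from assms obtain h where f: "f = (\<Sum>j\<in>{1..l}. pd j (h j))" and h: "\<And>j. h j \<in> regular l"
    by (auto simp: exact_functions_def)
  let ?u = "inverse (tvar (Suc l) - b)"
  have "pd j (h j) * ?u \<in> exact_functions (Suc l)" if j: "j \<in> {1..l}" for j
  proof -
    have u: "?u \<in> regular (Suc l)" by (rule inverse_fibre_diff) fact
    have r: "h j * pd j b \<in> regular l"
      using h punctures_regular[OF assms(2)] by (auto intro!: regular_mult regular_pd)
    have "pd (Suc l) (h j * pd j b * ?u) = - (h j * pd j b * ?u * ?u)"
      using pd_regular_eq_0[OF r, of "Suc l"]
        pd_regular_eq_0[OF punctures_regular[OF assms(2)], of "Suc l"]
      by (simp add: pd_mult[of _ "h j * pd j b"] pd_inverse pd_diff pd_tvar)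
    moreover have "pd j (h j * ?u) = pd j (h j) * ?u + h j * pd j b * ?u * ?u"
      using j by (simp add: pd_mult pd_inverse pd_diff pd_tvar)
    ultimately have "pd j (h j) * ?u = pd j (h j * ?u) + pd (Suc l) (h j * pd j b * ?u)"
      by simp
    moreover have "\<dots> \<in> exact_functions (Suc l)"
      using j by (intro exact_functions_add exact_functions_pd regular_mult[OF regular_mono[OF r] u]
          regular_mult[OF regular_mono[OF h] u]) auto
    ultimately show ?thesis by simp
  qed
  then show ?thesis
    unfolding f sum_distrib_right by (rule exact_functions_sum)
qed

section \<open>Insertion of a marked point into a 01 cell-form\<close>

text \<open>The denominator of a cell-form, by recursion on the list and not on indices, so that a
  list can be cut at a point shared by both pieces (\<open>step_prod_append\<close>).\<close>

fun step_prod :: "marked_point list \<Rightarrow> ratfun" where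
  "step_prod (x # y # zs) = (coord y - coord x) * step_prod (y # zs)"
| "step_prod _ = 1"

lemma prod_steps_eq: "(\<Prod>i<length y - 1. coord (y ! Suc i) - coord (y ! i)) = step_prod y"
proof (induction y rule: step_prod.induct)
  case (1 x y zs)
  have "length (x # y # zs) - 1 = Suc (length (y # zs) - 1)" by simp
  then show ?case
    using 1 by (simp only: prod.lessThan_Suc_shift) simp
qed simp_all

lemma step_prod_append: "step_prod (xs @ x # ys) = step_prod (xs @ [x]) * step_prod (x # ys)"
  by (induction xs rule: step_prod.induct) (simp_all add: mult.assoc)

lemma before_infinity_append:
  "Pt_inf \<notin> set A \<Longrightarrow> before_infinity (A @ Pt_inf # B) = B @ A"
proof -
  assume "Pt_inf \<notin> set A"
  then have "\<And>x. x \<in> set A \<Longrightarrow> x \<noteq> Pt_inf" by blast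
  then show ?thesis
    by (simp add: before_infinity_def takeWhile_append2 dropWhile_append2)
qed

lemma coord_eq_iff: "x \<noteq> Pt_inf \<Longrightarrow> y \<noteq> Pt_inf \<Longrightarrow> coord x = coord y \<longleftrightarrow> x = y"
  by (cases x; cases y) (simp_all add: tvar_neq_0[symmetric] tvar_neq_1[symmetric])

definition cell_fun :: "marked_point list \<Rightarrow> ratfun" where
  "cell_fun \<pi> = inverse (step_prod (before_infinity (Pt_0 # Pt_1 # \<pi>)))"

lemma cell_form_eq: "cell_form (l + 3) (Pt_0 # Pt_1 # \<pi>) = Poly_Mapping.single {1..l} (cell_fun \<pi>)"
  unfolding cell_form_def Let_def prod_steps_eq cell_fun_def by (simp add: inverse_eq_divide)

text \<open>A neighbour \<open>\<infinity>\<close> contributes no factor to a cell-form, hence the value \<open>0\<close>.\<close>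

definition simple_pole :: "nat \<Rightarrow> marked_point \<Rightarrow> ratfun" where
  "simple_pole i x = (if x = Pt_inf then 0 else inverse (tvar i - coord x))"

text \<open>The insertion replaces the factor b - a by (u - a)(b - u), and 1/((u - a)(b - u)) =
  (1/(u - a) - 1/(u - b))/(b - a).\<close>

lemma insert_between:
  assumes "coord x \<noteq> coord y" "coord x \<noteq> tvar i" "coord y \<noteq> tvar i"
  shows "inverse (step_prod (A @ x # Pt_t i # y # B)) =
    inverse (step_prod (A @ x # y # B)) * (inverse (tvar i - coord x) - inverse (tvar i - coord y))"
proof -
  have "inverse ((u - a) * (b - u)) = inverse (b - a) * (inverse (u - a) - inverse (u - b))"
    if "a \<noteq> b" "a \<noteq> u" "b \<noteq> u" for a b u :: ratfun
  proof -
    have "inverse (u - a) - inverse (u - b) = (b - a) * inverse ((u - a) * (b - u))"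
      using that by (simp add: divide_simps) (simp add: algebra_simps)
    then show ?thesis using that by simp
  qed
  from this[OF assms] show ?thesis
    by (simp add: step_prod_append[of A x "Pt_t i # y # B"] step_prod_append[of A x "y # B"])
qed

text \<open>\<open>Pt_1\<close> and \<open>Pt_0\<close> close up the list: they are the neighbours
  of the new point when it stands first or last. After rotating infinity to the end, either the new
  point has two finite neighbours and \<open>insert_between\<close> applies, or it was next to
  infinity and becomes an end of the list, where it adds a single factor. Whether infinity lies in
  \<open>P\<close> or in \<open>Q\<close> decides where the list is cut.\<close>

lemma cell_fun_insert:
  assumes "distinct (P @ Q)" "Pt_inf \<in> set (P @ Q)" "Pt_0 \<notin> set (P @ Q)" "Pt_1 \<notin> set (P @ Q)"
    "Pt_t i \<notin> set (P @ Q)"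
  shows "cell_fun (P @ Pt_t i # Q) =
    cell_fun (P @ Q) * (simple_pole i (last (Pt_1 # P)) - simple_pole i (hd (Q @ [Pt_0])))"
proof (cases "Pt_inf \<in> set P")
  case True
  then obtain P1 P2 where P: "P = P1 @ Pt_inf # P2" by (auto simp: in_set_conv_decomp)
  have 1: "before_infinity (Pt_0 # Pt_1 # P @ Pt_t i # Q) = P2 @ Pt_t i # Q @ Pt_0 # Pt_1 # P1"
    "before_infinity (Pt_0 # Pt_1 # P @ Q) = P2 @ Q @ Pt_0 # Pt_1 # P1"
    using before_infinity_append[of "Pt_0 # Pt_1 # P1"] assms(1) P by simp_all
  obtain y Q' where y: "Q @ [Pt_0] = y # Q'" by (cases "Q @ [Pt_0]") auto
  have Q: "Q @ Pt_0 # Pt_1 # P1 = y # Q' @ Pt_1 # P1"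
    using arg_cong[OF y, of "\<lambda>z. z @ Pt_1 # P1"] by simp
  have "y \<in> set (Q @ [Pt_0])" by (simp add: y)
  then have y': "y \<noteq> Pt_inf" "y \<noteq> Pt_t i" "y \<notin> set P2" using assms P by auto
  have cy: "coord y \<noteq> tvar i" using coord_eq_iff[of y "Pt_t i"] y' by simp
  have hd: "hd (Q @ [Pt_0]) = y" by (simp add: y)
  show ?thesis
  proof (cases P2 rule: rev_cases)
    \<comment> \<open>Right after infinity, the new point becomes the first finite entry. The extra
      factor is \<open>coord y - tvar i\<close>, whose sign agrees with the minus sign of the right
      neighbour.\<close>
    case Nil
    have "inverse (coord y - tvar i) = - inverse (tvar i - coord y)"
      by (metis inverse_minus_eq minus_diff_eq)
    then show ?thesis
      unfolding cell_fun_def 1 hd Q using Nil y' by (simp add: simple_pole_def P)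
  next
    case (snoc P' x)
    then have x: "x \<noteq> Pt_inf" "x \<noteq> Pt_t i" "x \<noteq> y" using assms P y' by auto
    have "coord x \<noteq> coord y" "coord x \<noteq> tvar i"
      using coord_eq_iff[of x y] coord_eq_iff[of x "Pt_t i"] x y' by simp_all
    from insert_between[OF this cy, of P'] show ?thesis
      unfolding cell_fun_def 1 hd Q using snoc x y' by (simp add: simple_pole_def P)
  qed
next
  case False
  then obtain Q1 Q2 where Q: "Q = Q1 @ Pt_inf # Q2" and Q1: "Pt_inf \<notin> set Q1"
    using assms(2) split_list_first[of Pt_inf Q] by auto
  have 1: "before_infinity (Pt_0 # Pt_1 # P @ Pt_t i # Q) = Q2 @ Pt_0 # Pt_1 # P @ Pt_t i # Q1"
    "before_infinity (Pt_0 # Pt_1 # P @ Q) = Q2 @ Pt_0 # Pt_1 # P @ Q1"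
    using before_infinity_append[of "Pt_0 # Pt_1 # P @ Pt_t i # Q1" Q2]
      before_infinity_append[of "Pt_0 # Pt_1 # P @ Q1" Q2] False Q1 by (simp_all add: Q)
  define x where "x = last (Pt_1 # P)"
  obtain P' where P': "Pt_1 # P = P' @ [x]"
    unfolding x_def by (metis append_butlast_last_id list.distinct(1))
  have P: "Q2 @ Pt_0 # Pt_1 # P @ R = (Q2 @ Pt_0 # P') @ x # R" for R
    using arg_cong[OF P', of "\<lambda>z. z @ R"] by simp
  have "x \<in> set (Pt_1 # P)" by (simp add: P')
  then have x: "x \<noteq> Pt_inf" "x \<noteq> Pt_t i" "x \<notin> set Q1" using assms False Q by auto
  have cx: "coord x \<noteq> tvar i" using coord_eq_iff[of x "Pt_t i"] x by simp
  show ?thesis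
  proof (cases Q1)
    case Nil
    then show ?thesis
      unfolding cell_fun_def 1 P x_def[symmetric] using x
      by (simp add: simple_pole_def Q step_prod_append[of "Q2 @ Pt_0 # P'" x "[Pt_t i]", simplified])
  next
    case (Cons y Q')
    then have y: "y \<noteq> Pt_inf" "y \<noteq> Pt_t i" "x \<noteq> y" using assms Q x Q1 by auto
    have "coord x \<noteq> coord y" "coord y \<noteq> tvar i"
      using coord_eq_iff[of x y] coord_eq_iff[of y "Pt_t i"] x y by simp_all
    from insert_between[OF this(1) cx this(2), of "Q2 @ Pt_0 # P'" Q'] show ?thesis
      unfolding cell_fun_def 1 P x_def[symmetric] using Cons x y by (simp add: simple_pole_def Q)
  qed
qed

section \<open>Orderings of the marked points and their gaps\<close>

definition orderings :: "nat \<Rightarrow> marked_point list set" where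
  "orderings l = permutations_of_set (insert Pt_inf (Pt_t ` {1..l}))"

definition insert_at :: "nat \<Rightarrow> nat \<Rightarrow> marked_point list \<Rightarrow> marked_point list" where
  "insert_at l k \<pi> = take k \<pi> @ Pt_t (Suc l) # drop k \<pi>"

lemma orderings_iff: "\<pi> \<in> orderings l \<longleftrightarrow> set \<pi> = insert Pt_inf (Pt_t ` {1..l}) \<and> distinct \<pi>"
  by (simp add: orderings_def permutations_of_set_def)

lemma length_orderings: "\<pi> \<in> orderings l \<Longrightarrow> length \<pi> = Suc l"
proof -
  assume "\<pi> \<in> orderings l"
  then have "length \<pi> = card (insert Pt_inf (Pt_t ` {1..l}))"
    by (metis distinct_card orderings_iff)
  also have "\<dots> = Suc l"
    by (subst card_insert_disjoint) (auto simp: card_image inj_on_def)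
  finally show ?thesis .
qed

text \<open>The inverse deletes the last variable and records where it stood. This is the recursion
  (l+2)! = (l+2) (l+1)! behind the count of the cell-forms.\<close>

lemma bij_betw_insert_at:
  "bij_betw (\<lambda>(\<pi>, k). insert_at l k \<pi>) (orderings l \<times> {..Suc l}) (orderings (Suc l))"
proof (rule bij_betwI')
  fix p q assume "p \<in> orderings l \<times> {..Suc l}" "q \<in> orderings l \<times> {..Suc l}"
  then obtain \<pi> k \<rho> j where p: "p = (\<pi>, k)" "\<pi> \<in> orderings l" "k \<le> Suc l"
    and q: "q = (\<rho>, j)" "\<rho> \<in> orderings l" "j \<le> Suc l" by auto
  have notin: "Pt_t (Suc l) \<notin> set \<pi>" "Pt_t (Suc l) \<notin> set \<rho>"
    using p q by (auto simp: orderings_iff)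
  show "((case p of (\<pi>, k) \<Rightarrow> insert_at l k \<pi>) = (case q of (\<pi>, k) \<Rightarrow> insert_at l k \<pi>)) = (p = q)"
  proof
    assume "(case p of (\<pi>, k) \<Rightarrow> insert_at l k \<pi>) = (case q of (\<pi>, k) \<Rightarrow> insert_at l k \<pi>)"
    then have eq: "take k \<pi> @ Pt_t (Suc l) # drop k \<pi> = take j \<rho> @ Pt_t (Suc l) # drop j \<rho>"
      by (simp add: p q insert_at_def)
    moreover have "Pt_t (Suc l) \<notin> set (take k \<pi>)" "Pt_t (Suc l) \<notin> set (take j \<rho>)"
        "Pt_t (Suc l) \<notin> set (drop k \<pi>)" "Pt_t (Suc l) \<notin> set (drop j \<rho>)"
      using notin by (auto dest: in_set_takeD in_set_dropD)
    ultimately have eqs: "take k \<pi> = take j \<rho>" "drop k \<pi> = drop j \<rho>"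
      by (auto simp: append_eq_append_conv2 Cons_eq_append_conv append_eq_Cons_conv)
    then have "\<pi> = \<rho>" by (metis append_take_drop_id)
    moreover have "k = j"
      using arg_cong[OF eqs(1), of length] length_orderings[OF p(2)]
        length_orderings[OF q(2)] p(3) q(3) by simp
    ultimately show "p = q" by (simp add: p q)
  qed simp
next
  fix p assume "p \<in> orderings l \<times> {..Suc l}"
  then obtain \<pi> k where p: "p = (\<pi>, k)" "\<pi> \<in> orderings l" by auto
  have u: "set (take k \<pi>) \<union> set (drop k \<pi>) = set \<pi>"
    by (simp flip: set_append)
  have d: "distinct (take k \<pi> @ drop k \<pi>)"
    using p by (simp add: orderings_iff)
  have "Pt_t (Suc l) \<notin> set (take k \<pi>) \<union> set (drop k \<pi>)"
    unfolding u using p by (auto simp: orderings_iff)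
  then have "distinct (insert_at l k \<pi>)"
    using d unfolding insert_at_def distinct_append by auto
  moreover have "set (insert_at l k \<pi>) = insert (Pt_t (Suc l)) (set \<pi>)"
    unfolding u[symmetric] by (auto simp: insert_at_def)
  ultimately show "(case p of (\<pi>, k) \<Rightarrow> insert_at l k \<pi>) \<in> orderings (Suc l)"
    using p by (auto simp: orderings_iff atLeastAtMostSuc_conv)
next
  fix \<sigma> assume s: "\<sigma> \<in> orderings (Suc l)"
  then have "Pt_t (Suc l) \<in> set \<sigma>" by (auto simp: orderings_iff)
  then obtain P Q where \<sigma>: "\<sigma> = P @ Pt_t (Suc l) # Q" by (auto simp: in_set_conv_decomp)
  have "set (P @ Q) = set \<sigma> - {Pt_t (Suc l)}"
    using s \<sigma> by (auto simp: orderings_iff)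
  also have "\<dots> = insert Pt_inf (Pt_t ` {1..l})"
    using s by (auto simp: orderings_iff atLeastAtMostSuc_conv)
  finally have w: "P @ Q \<in> orderings l" using s \<sigma> by (auto simp: orderings_iff)
  then show "\<exists>p\<in>orderings l \<times> {..Suc l}. \<sigma> = (case p of (\<pi>, k) \<Rightarrow> insert_at l k \<pi>)"
    using length_orderings[OF w] by (intro bexI[of _ "(P @ Q, length P)"]) (auto simp: \<sigma> insert_at_def)
qed

lemma sum_orderings_Suc:
  "(\<Sum>\<sigma>\<in>orderings (Suc l). F \<sigma>) = (\<Sum>\<pi>\<in>orderings l. \<Sum>k\<le>Suc l. F (insert_at l k \<pi>))"
proof -
  have "(\<Sum>\<sigma>\<in>orderings (Suc l). F \<sigma>) =
      (\<Sum>p\<in>orderings l \<times> {..Suc l}. F (case p of (\<pi>, k) \<Rightarrow> insert_at l k \<pi>))"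
    by (rule sum.reindex_bij_betw[OF bij_betw_insert_at, symmetric])
  also have "\<dots> = (\<Sum>(\<pi>, k)\<in>orderings l \<times> {..Suc l}. F (insert_at l k \<pi>))"
    by (simp only: split_def)
  also have "\<dots> = (\<Sum>\<pi>\<in>orderings l. \<Sum>k\<le>Suc l. F (insert_at l k \<pi>))"
    by (rule sum.cartesian_product[symmetric])
  finally show ?thesis .
qed

text \<open>The marked points in cyclic order, opened between \<open>0\<close> and \<open>1\<close>: the new point is never
  inserted into that gap.\<close>

definition cyclic_points :: "marked_point list \<Rightarrow> marked_point list" where
  "cyclic_points \<pi> = Pt_1 # \<pi> @ [Pt_0]"

text \<open>As \<open>cyclic_points\<close> puts \<open>Pt_1\<close> in front, position k of the
  ordering is the gap between entries k and k + 1.\<close>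

lemma cell_fun_insert_at:
  assumes "\<pi> \<in> orderings l" "k \<le> Suc l"
  shows "cell_fun (insert_at l k \<pi>) = cell_fun \<pi> *
    (simple_pole (Suc l) (cyclic_points \<pi> ! k) - simple_pole (Suc l) (cyclic_points \<pi> ! Suc k))"
proof -
  have len: "length \<pi> = Suc l" using assms length_orderings by blast
  have "last (Pt_1 # take k \<pi>) = cyclic_points \<pi> ! k"
    using len assms(2)
    by (cases k) (auto simp: cyclic_points_def last_conv_nth nth_append take_Suc_conv_app_nth)
  moreover have "hd (drop k \<pi> @ [Pt_0]) = cyclic_points \<pi> ! Suc k"
    using len assms(2)
    by (cases "k = Suc l") (auto simp: cyclic_points_def hd_append hd_drop_conv_nth nth_append)
  moreover have "cell_fun (take k \<pi> @ Pt_t (Suc l) # drop k \<pi>) = cell_fun (take k \<pi> @ drop k \<pi>) *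
      (simple_pole (Suc l) (last (Pt_1 # take k \<pi>)) - simple_pole (Suc l) (hd (drop k \<pi> @ [Pt_0])))"
    using assms(1) by (intro cell_fun_insert) (auto simp: orderings_iff simp flip: set_append)
  ultimately show ?thesis by (simp add: insert_at_def)
qed

lemma length_cyclic_points: "\<pi> \<in> orderings l \<Longrightarrow> length (cyclic_points \<pi>) = l + 3"
  by (simp add: cyclic_points_def length_orderings)

lemma distinct_cyclic_points: "\<pi> \<in> orderings l \<Longrightarrow> distinct (cyclic_points \<pi>)"
  by (auto simp: cyclic_points_def orderings_iff)

lemma set_cyclic_points:
  "\<pi> \<in> orderings l \<Longrightarrow> set (cyclic_points \<pi>) = {Pt_0, Pt_1, Pt_inf} \<union> Pt_t ` {1..l}"
  by (auto simp: cyclic_points_def orderings_iff)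

text \<open>The two ends of \<open>cyclic_points\<close> are 1 and 0, so infinity lies strictly
  inside and each side of it contains a finite end from which residue equations can start.\<close>

lemma infinity_position:
  assumes "\<pi> \<in> orderings l"
  obtains m where "0 < m" "m \<le> Suc l" "cyclic_points \<pi> ! m = Pt_inf"
proof -
  have "Pt_inf \<in> set \<pi>" using assms by (simp add: orderings_iff)
  then obtain j where "j < length \<pi>" "\<pi> ! j = Pt_inf" by (auto simp: in_set_conv_nth)
  then show thesis
    using that[of "Suc j"] length_orderings[OF assms] by (simp add: cyclic_points_def nth_append)
qed

lemma coord_cyclic_points:
  assumes "\<pi> \<in> orderings l"
  shows "coord ` (set (cyclic_points \<pi>) - {Pt_inf}) = punctures l"
proof -
  have "{Pt_0, Pt_1, Pt_inf} \<union> Pt_t ` {1..l} - {Pt_inf} = {Pt_0, Pt_1} \<union> Pt_t ` {1..l}" by auto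
  then show ?thesis
    by (simp add: set_cyclic_points[OF assms] punctures_def image_image)
qed

lemma inverse_step_prod_regular:
  "coord ` set xs \<subseteq> punctures l \<Longrightarrow> inverse (step_prod xs) \<in> regular l"
  by (induction xs rule: step_prod.induct)
    (auto simp: regular_1 intro!: regular_mult inverse_punctures_diff)

lemma cell_fun_regular:
  assumes "\<pi> \<in> orderings l"
  shows "cell_fun \<pi> \<in> regular l"
proof -
  have "Pt_inf \<in> set \<pi>" using assms by (simp add: orderings_iff)
  then obtain A B where \<pi>: "\<pi> = A @ Pt_inf # B" "Pt_inf \<notin> set A" by (metis split_list_first)
  then have "before_infinity (Pt_0 # Pt_1 # \<pi>) = B @ Pt_0 # Pt_1 # A"
    using before_infinity_append[of "Pt_0 # Pt_1 # A" B] by simp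
  moreover have "set (B @ Pt_0 # Pt_1 # A) \<subseteq> set (cyclic_points \<pi>) - {Pt_inf}"
    using assms \<pi> by (auto simp: cyclic_points_def orderings_iff)
  ultimately show ?thesis
    using coord_cyclic_points[OF assms] unfolding cell_fun_def
    by (metis image_mono inverse_step_prod_regular)
qed

section \<open>Spanning\<close>

definition cell_comb :: "nat \<Rightarrow> (marked_point list \<Rightarrow> rat) \<Rightarrow> ratfun" where
  "cell_comb l a = (\<Sum>\<pi>\<in>orderings l. const (a \<pi>) * cell_fun \<pi>)"

definition cell_span :: "nat \<Rightarrow> ratfun set" where
  "cell_span l = {f. \<exists>a. f - cell_comb l a \<in> exact_functions l}"

lemma finite_orderings [simp]: "finite (orderings l)"
  by (simp add: orderings_def)

lemma cell_comb_add: "cell_comb l (\<lambda>\<pi>. a \<pi> + b \<pi>) = cell_comb l a + cell_comb l b"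
  by (simp add: cell_comb_def const_add distrib_right sum.distrib)

lemma cell_comb_mult: "cell_comb l (\<lambda>\<pi>. c * a \<pi>) = const c * cell_comb l a"
  by (simp add: cell_comb_def const_mult sum_distrib_left mult.assoc)

lemma cell_span_add:
  assumes "f \<in> cell_span l" "g \<in> cell_span l"
  shows "f + g \<in> cell_span l"
proof -
  from assms obtain a b where
    "f - cell_comb l a \<in> exact_functions l" "g - cell_comb l b \<in> exact_functions l"
    by (auto simp: cell_span_def)
  then have "(f + g) - cell_comb l (\<lambda>\<pi>. a \<pi> + b \<pi>) \<in> exact_functions l"
    using exact_functions_add by (fastforce simp: cell_comb_add add_diff_add)
  then show ?thesis by (auto simp: cell_span_def)
qed

lemma cell_span_const_mult:
  assumes "f \<in> cell_span l"
  shows "const c * f \<in> cell_span l"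
proof -
  from assms obtain a where "f - cell_comb l a \<in> exact_functions l"
    by (auto simp: cell_span_def)
  from exact_functions_const_mult[OF this, of c]
  have "const c * f - cell_comb l (\<lambda>\<pi>. c * a \<pi>) \<in> exact_functions l"
    by (simp add: cell_comb_mult right_diff_distrib)
  then show ?thesis by (auto simp: cell_span_def)
qed

lemma cell_span_exact:
  assumes "f \<in> exact_functions l"
  shows "f \<in> cell_span l"
proof -
  have "cell_comb l (\<lambda>_. 0) = 0" by (simp add: cell_comb_def const_0)
  then have "f - cell_comb l (\<lambda>_. 0) \<in> exact_functions l" using assms by simp
  then show ?thesis unfolding cell_span_def by blast
qed

lemma cell_span_uminus: "f \<in> cell_span l \<Longrightarrow> - f \<in> cell_span l"
  using cell_span_const_mult[of f l "-1"] by (simp add: const_uminus const_1)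

lemma cell_span_sum: "(\<And>x. x \<in> A \<Longrightarrow> f x \<in> cell_span l) \<Longrightarrow> sum f A \<in> cell_span l"
  by (induction A rule: infinite_finite_induct)
    (auto simp: cell_span_add intro: cell_span_exact exact_functions_0)

lemma cell_comb_indicator:
  assumes "\<pi> \<in> orderings l"
  shows "cell_comb l (\<lambda>\<rho>. if \<rho> = \<pi> then 1 else 0) = cell_fun \<pi>"
proof -
  have "cell_comb l (\<lambda>\<rho>. if \<rho> = \<pi> then 1 else 0) =
      (\<Sum>\<rho>\<in>orderings l. if \<rho> = \<pi> then cell_fun \<rho> else 0)"
    unfolding cell_comb_def by (intro sum.cong) (auto simp: const_0 const_1)
  then show ?thesis using assms by simp
qed

lemma cell_span_cell_fun:
  assumes "\<pi> \<in> orderings l"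
  shows "cell_fun \<pi> \<in> cell_span l"
proof -
  have "cell_fun \<pi> - cell_comb l (\<lambda>\<rho>. if \<rho> = \<pi> then 1 else 0) \<in> exact_functions l"
    using assms by (simp add: cell_comb_indicator exact_functions_0)
  then show ?thesis unfolding cell_span_def by blast
qed

text \<open>Inserting the new point into all gaps between \<open>b\<close> and \<open>\<infinity>\<close> gives a telescoping sum.\<close>

lemma cell_fun_mult_simple_pole:
  assumes \<pi>: "\<pi> \<in> orderings l" and b: "b \<in> punctures l"
  shows "cell_fun \<pi> * inverse (tvar (Suc l) - b) \<in> cell_span (Suc l)"
proof -
  let ?z = "cyclic_points \<pi>" and ?p = "\<lambda>k. simple_pole (Suc l) (cyclic_points \<pi> ! k)"
  obtain m where m: "0 < m" "m \<le> Suc l" "?z ! m = Pt_inf"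
    by (rule infinity_position[OF \<pi>])
  obtain x where x: "x \<in> set ?z" "x \<noteq> Pt_inf" "b = coord x"
    using b coord_cyclic_points[OF \<pi>] by auto
  then obtain j where "j < l + 3" "?z ! j = x"
    using length_cyclic_points[OF \<pi>] by (auto simp: in_set_conv_nth)
  then have j: "j \<le> Suc (Suc l)" "?z ! j = x" by simp_all
  have pj: "inverse (tvar (Suc l) - b) = ?p j" and pm: "?p m = 0"
    using x j m by (simp_all add: simple_pole_def)
  have gap: "cell_fun \<pi> * (?p k - ?p (Suc k)) \<in> cell_span (Suc l)" if "k \<le> Suc l" for k
  proof -
    have "insert_at l k \<pi> \<in> orderings (Suc l)"
      using bij_betwE[OF bij_betw_insert_at[of l]] \<pi> that by fastforce
    then show ?thesis using cell_span_cell_fun cell_fun_insert_at[OF \<pi> that] by metis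
  qed
  have range: "cell_fun \<pi> * (?p i - ?p k) \<in> cell_span (Suc l)"
    if "i \<le> k" "k \<le> Suc (Suc l)" for i k
  proof -
    have "(\<Sum>r\<in>{i..<k}. ?p r - ?p (Suc r)) = ?p i - ?p k"
      using that sum_Suc_diff'[of i k "\<lambda>r. - ?p r"] by simp
    then have "cell_fun \<pi> * (?p i - ?p k) = (\<Sum>r\<in>{i..<k}. cell_fun \<pi> * (?p r - ?p (Suc r)))"
      by (simp only: sum_distrib_left[symmetric])
    also have "\<dots> \<in> cell_span (Suc l)"
      using that by (intro cell_span_sum gap) auto
    finally show ?thesis .
  qed
  show ?thesis
  \<comment> \<open>The sum always runs from the earlier to the later of b and infinity and so
    avoids the passage from 0 back to 1. Their order only decides the sign.\<close>
  proof (cases "j \<le> m")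
    case True
    then show ?thesis using range[of j m] m(2) by (simp add: pj pm)
  next
    case False
    then show ?thesis using cell_span_uminus[OF range[of m j]] j by (simp add: pj pm)
  qed
qed

text \<open>Powers of t and poles of order at least two have primitives along the fibre, because
  their numerical factors can be inverted in the rationals. For a simple pole the induction
  hypothesis turns the coefficient into cell functions modulo \<open>exact_functions l\<close>, and
  the error term stays exact after multiplication by the pole.\<close>

lemma regular_subset_cell_span: "f \<in> regular l \<Longrightarrow> f \<in> cell_span l"
proof (induction l arbitrary: f)
  case 0
  have o: "orderings 0 = {[Pt_inf]}" by (simp add: orderings_def)
  have c: "cell_fun [Pt_inf] = 1"
    by (simp add: cell_fun_def before_infinity_def)
  \<comment> \<open>For \<open>l = 0\<close> every generator apart from the constants has an empty
    index range.\<close>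
  from 0 have "\<exists>c. f = const c"
    by (induction rule: regular_induct) (auto simp flip: const_add const_mult)
  then show ?case
    using cell_span_const_mult[OF cell_span_cell_fun[of "[Pt_inf]" 0]] by (auto simp: o c)
next
  case (Suc l)
  let ?t = "tvar (Suc l)"
  have t: "?t \<in> regular (Suc l)" by (rule regular_tvar) simp
  have pd: "pd (Suc l) f \<in> cell_span (Suc l)" if "f \<in> regular (Suc l)" for f
    using that by (intro cell_span_exact exact_functions_pd) auto
  from Suc.prems have "f \<in> partial_fractions l" by (rule regular_Suc_partial_fractions)
  then show ?case
  proof (induction rule: partial_fractions.induct)
    case (power f k)
    have "pd (Suc l) (f * ?t ^ Suc k) = of_nat (Suc k) * (f * ?t ^ k)"
      using pd_regular_eq_0[OF power, of "Suc l"] pd_power[of "Suc l" ?t "Suc k"]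
      by (simp add: pd_mult pd_tvar)
    then have "const (inverse (of_nat (Suc k))) * pd (Suc l) (f * ?t ^ Suc k) = f * ?t ^ k"
      using const_inverse_of_nat_mult[of "Suc k"] by (simp only: mult.assoc[symmetric]) simp
    moreover have "pd (Suc l) (f * ?t ^ Suc k) \<in> cell_span (Suc l)"
      using power t by (intro pd regular_mult regular_power regular_mono[OF power]) auto
    ultimately show ?case by (metis cell_span_const_mult)
  next
    case (pole f b k)
    let ?u = "inverse (?t - b)"
    have u: "?u \<in> regular (Suc l)" using pole by (intro inverse_fibre_diff)
    show ?case
    proof (cases k)
      case 0
      obtain a where a: "f - cell_comb l a \<in> exact_functions l"
        using Suc.IH[OF pole(1)] by (auto simp: cell_span_def)
      have "f * ?u = (f - cell_comb l a) * ?u + (\<Sum>\<pi>\<in>orderings l. const (a \<pi>) * (cell_fun \<pi> * ?u))"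
        by (simp add: cell_comb_def left_diff_distrib sum_distrib_right mult.assoc)
      also have "\<dots> \<in> cell_span (Suc l)"
        using a pole
        by (intro cell_span_add cell_span_sum cell_span_const_mult cell_fun_mult_simple_pole
            cell_span_exact exact_mult_simple_pole) auto
      finally show ?thesis using 0 by simp
    next
      case (Suc r)
      have z: "pd (Suc l) f = 0" "pd (Suc l) b = 0"
        using pd_regular_eq_0[OF pole(1), of "Suc l"]
          pd_regular_eq_0[OF punctures_regular[OF pole(2)], of "Suc l"] by simp_all
      have "pd (Suc l) (f * ?u ^ Suc r) = - (const (of_nat (Suc r)) * f * ?u ^ Suc k)"
        using pd_fibre_pole[OF pole(1,2), of "Suc l" r] unfolding Suc z by simp
      then have "f * ?u ^ Suc k =
          const (- inverse (of_nat (Suc r))) * pd (Suc l) (f * ?u ^ Suc r)"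
        by (simp add: mult.assoc[symmetric] const_mult[symmetric] const_uminus const_1 del: power_Suc)
      moreover have "pd (Suc l) (f * ?u ^ Suc r) \<in> cell_span (Suc l)"
        using pole u by (intro pd regular_mult regular_power regular_mono[OF pole(1)]) auto
      ultimately show ?thesis by (metis cell_span_const_mult)
    qed
  next
    case (add f g)
    then show ?case by (intro cell_span_add)
  qed
qed

section \<open>Independence\<close>

lemma fibre_residue_simple_pole:
  assumes "x \<noteq> Pt_inf" "coord x \<in> punctures l" "y \<noteq> Pt_inf \<Longrightarrow> coord y \<in> punctures l"
  shows "fibre_residue l (coord x) (simple_pole (Suc l) y) = const (of_bool (x = y))"
proof (cases "y = Pt_inf")
  case False
  then show ?thesis
    using fibre_residue_pole[OF assms(2) assms(3)[OF False], of 0] assms(1) coord_eq_iff[of x y]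
    by (simp add: simple_pole_def const_0 const_1)
qed (use assms(1) in \<open>simp add: simple_pole_def const_0\<close>)

text \<open>\<open>cell_fun\<close> of the old ordering comes from the base and can be pulled out.
  Of the difference of simple poles, the residue at x sees +1 if x is the left neighbour of the gap
  and -1 if it is the right one.\<close>

lemma fibre_residue_insert_at:
  assumes "\<pi> \<in> orderings l" "k \<le> Suc l" "x \<in> set (cyclic_points \<pi>)" "x \<noteq> Pt_inf"
  shows "fibre_residue l (coord x) (cell_fun (insert_at l k \<pi>)) =
    const (of_bool (x = cyclic_points \<pi> ! k) - of_bool (x = cyclic_points \<pi> ! Suc k)) * cell_fun \<pi>"
proof -
  have pt: "coord (cyclic_points \<pi> ! j) \<in> punctures l"
    if "j \<le> Suc (Suc l)" "cyclic_points \<pi> ! j \<noteq> Pt_inf" for j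
    using coord_cyclic_points[OF assms(1)] that length_cyclic_points[OF assms(1)] by auto
  have x: "coord x \<in> punctures l"
    using coord_cyclic_points[OF assms(1)] assms(3,4) by auto
  have diff: "fibre_residue l b (f - g) = fibre_residue l b f - fibre_residue l b g" for b f g
    using fibre_residue_add[of l b "f - g" g] by simp
  have cd: "const (a - b) = const a - const b" for a b
    using const_add[of "a - b" b] by simp
  show ?thesis
    unfolding cell_fun_insert_at[OF assms(1,2)]
      fibre_residue_mult_regular[OF cell_fun_regular[OF assms(1)]]
    using assms(2,4) x pt[of k] pt[of "Suc k"]
    by (simp add: diff fibre_residue_simple_pole cd mult.commute)
qed

text \<open>The residue at a marked point compares the coefficients of the insertions immediately
  after and before it. Outside the range of gaps and at \<open>\<infinity>\<close> (position \<open>m\<close>) this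
  forces the coefficients to vanish from both ends.\<close>

lemma gap_coefficients_zero:
  fixes a :: "nat \<Rightarrow> 'a::zero"
  assumes "0 < m" "m \<le> N"
    and eq: "\<And>j. j \<le> Suc N \<Longrightarrow> j \<noteq> m \<Longrightarrow>
      (if j \<le> N then a j else 0) = (if 0 < j then a (j - 1) else 0)"
    and "k \<le> N"
  shows "a k = 0"
proof (cases "k < m")
  case True
  then show ?thesis
  proof (induction k)
    case 0
    then show ?case using eq[of 0] by simp
  next
    case (Suc k)
    then show ?case using eq[of "Suc k"] assms(2) by simp
  qed
next
  case False
  \<comment> \<open>Beyond m the descent starts at the last gap: the equation for
    \<open>j = Suc N\<close> reads \<open>0 = a N\<close>.\<close>
  show ?thesis
    using \<open>k \<le> N\<close> False
  proof (induction k rule: inc_induct)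
    case base
    then show ?case using eq[of "Suc N"] assms(2) by simp
  next
    case (step k)
    then show ?case using eq[of "Suc k"] by simp
  qed
qed

text \<open>The residue of an exact combination is an exact combination of cell functions one
  dimension lower, so the induction hypothesis kills its coefficients. For each ordering these are
  linear equations in the coefficients of its insertions, solved by
  \<open>gap_coefficients_zero\<close>. In dimension 0 only 0 is exact.\<close>

lemma cell_comb_exact_imp_0:
  "cell_comb l a \<in> exact_functions l \<Longrightarrow> \<pi> \<in> orderings l \<Longrightarrow> a \<pi> = 0"
proof (induction l arbitrary: a \<pi>)
  case 0
  have o: "orderings 0 = {[Pt_inf]}" by (simp add: orderings_def)
  have c: "cell_fun [Pt_inf] = 1"
    by (simp add: cell_fun_def before_infinity_def)
  show ?case using 0 by (simp add: cell_comb_def o c exact_functions_0_dim)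
next
  case (Suc l a \<sigma>)
  \<comment> \<open>The coefficient of the old cell function in the residue at x, collected over all
    gaps.\<close>
  define w where "w x \<pi> = (\<Sum>k\<le>Suc l. a (insert_at l k \<pi>) *
      (of_bool (x = cyclic_points \<pi> ! k) - of_bool (x = cyclic_points \<pi> ! Suc k)))" for x \<pi>
  have const_sum: "const (sum f A) = (\<Sum>x\<in>A. const (f x))" for f and A :: "nat set"
    by (induction A rule: infinite_finite_induct) (simp_all add: const_0 const_add)
  have w0: "w x \<pi> = 0" if \<pi>: "\<pi> \<in> orderings l" and x: "x \<in> set (cyclic_points \<pi>)" "x \<noteq> Pt_inf" for x \<pi>
  proof -
    \<comment> \<open>All orderings have the same set of cyclic points, so one x serves for every
      summand of the combination.\<close>
    have x': "x \<in> set (cyclic_points \<rho>)" if "\<rho> \<in> orderings l" for \<rho>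
      using x(1) by (simp add: set_cyclic_points[OF \<pi>] set_cyclic_points[OF that])
    have b: "coord x \<in> punctures l" using coord_cyclic_points[OF \<pi>] x by auto
    have "fibre_residue l (coord x) (cell_comb (Suc l) a) =
        (\<Sum>\<rho>\<in>orderings l. \<Sum>k\<le>Suc l. const (a (insert_at l k \<rho>)) *
          fibre_residue l (coord x) (cell_fun (insert_at l k \<rho>)))"
      by (simp only: cell_comb_def fibre_residue_sum fibre_residue_const_mult sum_orderings_Suc)
    also have "\<dots> = (\<Sum>\<rho>\<in>orderings l. const (w x \<rho>) * cell_fun \<rho>)"
      unfolding w_def const_sum sum_distrib_right
      by (intro sum.cong refl)
        (simp only: fibre_residue_insert_at x' x(2) atMost_iff const_mult mult.assoc not_False_eq_True)
    finally have "cell_comb l (w x) \<in> exact_functions l"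
      using fibre_residue_exact[OF b Suc.prems(1)] by (simp add: cell_comb_def)
    then show ?thesis using Suc.IH \<pi> by blast
  qed
  obtain \<pi> k where \<pi>: "\<pi> \<in> orderings l" "k \<le> Suc l" and \<sigma>: "\<sigma> = insert_at l k \<pi>"
    using Suc.prems(2) unfolding bij_betw_imp_surj_on[OF bij_betw_insert_at[of l], symmetric] by auto
  let ?z = "cyclic_points \<pi>"
  obtain m where m: "0 < m" "m \<le> Suc l" "?z ! m = Pt_inf"
    by (rule infinity_position[OF \<pi>(1)])
  have len: "length ?z = l + 3" and dist: "distinct ?z"
    using length_cyclic_points distinct_cyclic_points \<pi>(1) by blast+
  \<comment> \<open>The default values 0 stand for the missing gap between 0 and 1: the first point
    has no gap before it, and the last one has none after it.\<close>
  have "(if j \<le> Suc l then a (insert_at l j \<pi>) else 0) =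
      (if 0 < j then a (insert_at l (j - 1) \<pi>) else 0)" if j: "j \<le> Suc (Suc l)" "j \<noteq> m" for j
  proof -
    have "?z ! j \<noteq> Pt_inf"
      using j m len nth_eq_iff_index_eq[OF dist, of j m] by simp
    then have "0 = w (?z ! j) \<pi>" using w0[OF \<pi>(1), of "?z ! j"] j len by simp
    also have "\<dots> = (\<Sum>k\<le>Suc l. a (insert_at l k \<pi>) * (of_bool (j = k) - of_bool (j = Suc k)))"
      unfolding w_def using j len
      by (intro sum.cong refl) (simp add: nth_eq_iff_index_eq[OF dist])
    also have "\<dots> = (\<Sum>k\<le>Suc l. if k = j then a (insert_at l k \<pi>) else 0) -
        (\<Sum>k\<le>Suc l. if Suc k = j then a (insert_at l k \<pi>) else 0)"
      unfolding sum_subtractf[symmetric] by (intro sum.cong refl) auto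
    also have "(\<Sum>k\<le>Suc l. if k = j then a (insert_at l k \<pi>) else 0) =
        (if j \<le> Suc l then a (insert_at l j \<pi>) else 0)"
      by (subst sum.delta) auto
    also have "(\<Sum>k\<le>Suc l. if Suc k = j then a (insert_at l k \<pi>) else 0) =
        (if 0 < j then a (insert_at l (j - 1) \<pi>) else 0)"
    proof (cases j)
      case (Suc i)
      then show ?thesis using j by (simp add: sum.delta del: sum.atMost_Suc)
    qed simp
    finally show ?thesis by simp
  qed
  from gap_coefficients_zero[OF m(1,2) this \<pi>(2)] show ?case by (simp add: \<sigma>)
qed

section \<open>Quotient modules\<close>

text \<open>Closure under negation comes from scaling by -1.\<close>

lemma submodule_imp_abelian_subgroup:
  assumes "submodule R N M"
  shows "abelian_subgroup N M"
proof -
  interpret N: submodule R N M by fact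
  interpret module R M by (rule N.module)
  have "\<ominus>\<^bsub>M\<^esub> v \<in> N" if "v \<in> N" for v
  proof -
    have "(\<ominus>\<^bsub>R\<^esub> \<one>\<^bsub>R\<^esub>) \<odot>\<^bsub>M\<^esub> v \<in> N"
      using that by (intro N.smult_closed) auto
    then show ?thesis using that N.subset by (metis smult_minus_1 subsetD)
  qed
  then have "subgroup N (add_monoid M)"
    using N.subset by (intro subgroup.intro) (auto simp flip: a_inv_def)
  then show ?thesis
    by (intro abelian_subgroupI3 additive_subgroupI M.abelian_group_axioms)
qed

lemma quotient_module_simps:
  "carrier (quotient_module M N) = a_rcosets\<^bsub>M\<^esub> N"
  "zero (quotient_module M N) = N"
  "add (quotient_module M N) = (<+>\<^bsub>M\<^esub>)"
  by (simp_all add: quotient_module_def)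

context
  fixes R (structure) and N and M
  assumes sub: "submodule R N M"
begin

interpretation module R M using sub by (rule submodule.module)
interpretation Q: abelian_subgroup N M using sub by (rule submodule_imp_abelian_subgroup)

lemma carrier_quotient_moduleE:
  assumes "A \<in> carrier (quotient_module M N)"
  obtains x where "x \<in> carrier M" "A = N +>\<^bsub>M\<^esub> x"
  using assms by (auto simp: quotient_module_simps A_RCOSETS_def')

lemma coset_in_quotient_module:
  "x \<in> carrier M \<Longrightarrow> N +>\<^bsub>M\<^esub> x \<in> carrier (quotient_module M N)"
  unfolding quotient_module_simps by (rule M.a_rcosetsI[OF Q.a_subset])

lemma quotient_module_add:
  "x \<in> carrier M \<Longrightarrow> y \<in> carrier M \<Longrightarrow>
    (N +>\<^bsub>M\<^esub> x) \<oplus>\<^bsub>quotient_module M N\<^esub> (N +>\<^bsub>M\<^esub> y) = N +>\<^bsub>M\<^esub> (x \<oplus>\<^bsub>M\<^esub> y)"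
  unfolding quotient_module_simps by (rule Q.a_rcos_sum)

lemma coset_eq_iff:
  assumes "x \<in> carrier M" "y \<in> carrier M"
  shows "N +>\<^bsub>M\<^esub> x = N +>\<^bsub>M\<^esub> y \<longleftrightarrow> x \<ominus>\<^bsub>M\<^esub> y \<in> N"
proof -
  have "N +>\<^bsub>M\<^esub> x = N +>\<^bsub>M\<^esub> y \<longleftrightarrow> x \<in> N +>\<^bsub>M\<^esub> y"
    using Q.a_repr_independence'[of x y] Q.a_repr_independenceD[of x y] assms by auto
  also have "\<dots> \<longleftrightarrow> x \<ominus>\<^bsub>M\<^esub> y \<in> N"
    using Q.a_rcos_module[of y x] assms by (simp add: a_minus_def)
  finally show ?thesis .
qed

lemma coset_eq_submodule_iff: "x \<in> carrier M \<Longrightarrow> N +>\<^bsub>M\<^esub> x = N \<longleftrightarrow> x \<in> N"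
  using Q.a_rcos_const Q.a_rcos_self by metis

text \<open>All representatives of the coset give the same coset after scaling, so the union in
  \<open>quotient_module\<close> is a union of equal sets.\<close>

lemma quotient_module_smult:
  assumes "c \<in> carrier R" "x \<in> carrier M"
  shows "c \<odot>\<^bsub>quotient_module M N\<^esub> (N +>\<^bsub>M\<^esub> x) = N +>\<^bsub>M\<^esub> (c \<odot>\<^bsub>M\<^esub> x)"
proof -
  have "N +>\<^bsub>M\<^esub> (c \<odot>\<^bsub>M\<^esub> y) = N +>\<^bsub>M\<^esub> (c \<odot>\<^bsub>M\<^esub> x)" if y: "y \<in> N +>\<^bsub>M\<^esub> x" for y
  proof -
    obtain h where h: "h \<in> N" "y = h \<oplus>\<^bsub>M\<^esub> x" using y by (auto simp: a_r_coset_def')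
    have hc: "h \<in> carrier M" using h Q.a_subset by auto
    have "c \<odot>\<^bsub>M\<^esub> y = c \<odot>\<^bsub>M\<^esub> h \<oplus>\<^bsub>M\<^esub> c \<odot>\<^bsub>M\<^esub> x"
      using h hc assms by (simp add: smult_r_distr)
    moreover have "c \<odot>\<^bsub>M\<^esub> h \<in> N" using assms h sub by (simp add: submodule.smult_closed)
    ultimately have "c \<odot>\<^bsub>M\<^esub> y \<in> N +>\<^bsub>M\<^esub> (c \<odot>\<^bsub>M\<^esub> x)" by (auto simp: a_r_coset_def')
    then show ?thesis using Q.a_repr_independence' assms by (metis smult_closed)
  qed
  moreover have "x \<in> N +>\<^bsub>M\<^esub> x" using assms by (intro Q.a_rcos_self)
  ultimately have "(\<Union>y\<in>N +>\<^bsub>M\<^esub> x. N +>\<^bsub>M\<^esub> (c \<odot>\<^bsub>M\<^esub> y)) = N +>\<^bsub>M\<^esub> (c \<odot>\<^bsub>M\<^esub> x)" by blast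
  then show ?thesis by (simp add: quotient_module_def)
qed

lemma zero_quotient_module: "\<zero>\<^bsub>quotient_module M N\<^esub> = N +>\<^bsub>M\<^esub> \<zero>\<^bsub>M\<^esub>"
  using Q.a_rcos_const[OF Q.zero_closed] by (simp add: quotient_module_simps)

lemma module_quotient_module: "module R (quotient_module M N)"
proof (rule module_criteria)
  show "cring R" by (rule R.is_cring)
  show "\<zero>\<^bsub>quotient_module M N\<^esub> \<in> carrier (quotient_module M N)"
    by (simp add: zero_quotient_module coset_in_quotient_module)
  show "\<forall>v\<in>carrier (quotient_module M N). \<exists>w\<in>carrier (quotient_module M N).
      v \<oplus>\<^bsub>quotient_module M N\<^esub> w = \<zero>\<^bsub>quotient_module M N\<^esub>"
  proof
    fix v assume "v \<in> carrier (quotient_module M N)"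
    then obtain x where x: "x \<in> carrier M" "v = N +>\<^bsub>M\<^esub> x" by (rule carrier_quotient_moduleE)
    then have "v \<oplus>\<^bsub>quotient_module M N\<^esub> (N +>\<^bsub>M\<^esub> (\<ominus>\<^bsub>M\<^esub> x)) = \<zero>\<^bsub>quotient_module M N\<^esub>"
      by (simp add: quotient_module_add zero_quotient_module M.r_neg)
    then show "\<exists>w\<in>carrier (quotient_module M N).
        v \<oplus>\<^bsub>quotient_module M N\<^esub> w = \<zero>\<^bsub>quotient_module M N\<^esub>"
      using x coset_in_quotient_module by blast
  qed
qed (auto elim!: carrier_quotient_moduleE simp: quotient_module_add quotient_module_smult
      coset_in_quotient_module zero_quotient_module smult_assoc1 smult_l_distr smult_r_distr
      M.a_ac)

text \<open>A linear combination here is a sum over a set of vectors. Injectivity prevents two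
  elements of \<open>S\<close> with the same coset from being counted once on the left and twice on
  the right.\<close>

lemma lincomb_quotient_module:
  assumes "finite S" "S \<subseteq> carrier M" "inj_on (\<lambda>x. N +>\<^bsub>M\<^esub> x) S"
    and a: "\<And>x. x \<in> S \<Longrightarrow> a (N +>\<^bsub>M\<^esub> x) \<in> carrier R"
  shows "module.lincomb (quotient_module M N) a ((\<lambda>x. N +>\<^bsub>M\<^esub> x) ` S) =
    N +>\<^bsub>M\<^esub> module.lincomb M (\<lambda>x. a (N +>\<^bsub>M\<^esub> x)) S"
proof -
  interpret Q': module R "quotient_module M N" by (rule module_quotient_module)
  have "finsum (quotient_module M N) (\<lambda>x. N +>\<^bsub>M\<^esub> f x) T = N +>\<^bsub>M\<^esub> finsum M f T"
    if "finite T" "\<And>x. x \<in> T \<Longrightarrow> f x \<in> carrier M" for f T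
    using that
  proof (induction T rule: finite_induct)
    case empty
    then show ?case by (simp add: zero_quotient_module)
  next
    case (insert x T)
    then have "finsum M f T \<in> carrier M" by (intro M.finsum_closed) auto
    then show ?case
      using insert by (simp add: coset_in_quotient_module quotient_module_add)
  qed
  note finsum = this
  have "Q'.lincomb a ((\<lambda>x. N +>\<^bsub>M\<^esub> x) ` S) =
      finsum (quotient_module M N) (\<lambda>x. a (N +>\<^bsub>M\<^esub> x) \<odot>\<^bsub>quotient_module M N\<^esub> (N +>\<^bsub>M\<^esub> x)) S"
    unfolding Q'.lincomb_def using assms
    by (intro Q'.M.finsum_reindex) (auto intro!: Q'.smult_closed coset_in_quotient_module)
  also have "\<dots> = finsum (quotient_module M N) (\<lambda>x. N +>\<^bsub>M\<^esub> (a (N +>\<^bsub>M\<^esub> x) \<odot>\<^bsub>M\<^esub> x)) S"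
    using assms by (intro Q'.M.finsum_cong')
      (auto simp: quotient_module_smult subset_iff intro!: coset_in_quotient_module)
  also have "\<dots> = N +>\<^bsub>M\<^esub> lincomb (\<lambda>x. a (N +>\<^bsub>M\<^esub> x)) S"
    unfolding lincomb_def using assms by (intro finsum) auto
  finally show ?thesis .
qed

lemma vectorspace_quotient_module:
  assumes "field R"
  shows "vectorspace R (quotient_module M N)"
  using assms module_quotient_module by (simp add: vectorspace_def)

text \<open>Reduces a statement about cosets to spanning and independence modulo \<open>N\<close> of
  representatives, the form in which the results on functions are available.\<close>

lemma basis_quotient_module:
  assumes "field R" and S: "finite S" "S \<subseteq> carrier M" "inj_on (\<lambda>x. N +>\<^bsub>M\<^esub> x) S"
    and gen: "\<And>x. x \<in> carrier M \<Longrightarrow> \<exists>a\<in>S \<rightarrow> carrier R. x \<ominus>\<^bsub>M\<^esub> module.lincomb M a S \<in> N"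
    and indep: "\<And>a x. a \<in> S \<rightarrow> carrier R \<Longrightarrow> module.lincomb M a S \<in> N \<Longrightarrow> x \<in> S \<Longrightarrow> a x = \<zero>\<^bsub>R\<^esub>"
  shows "vectorspace.basis R (quotient_module M N) ((\<lambda>x. N +>\<^bsub>M\<^esub> x) ` S)"
proof -
  let ?c = "\<lambda>x. N +>\<^bsub>M\<^esub> x"
  interpret Q': vectorspace R "quotient_module M N"
    using assms(1) by (rule vectorspace_quotient_module)
  have carr: "?c ` S \<subseteq> carrier (quotient_module M N)"
    using S coset_in_quotient_module by blast
  have closed: "lincomb a S \<in> carrier M" if "a \<in> S \<rightarrow> carrier R" for a
    using S that by (intro lincomb_closed)
  have "Q'.lin_indpt (?c ` S)"
  proof (rule Q'.finite_lin_indpt2)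
    fix a assume a: "a \<in> ?c ` S \<rightarrow> carrier R"
      and 0: "Q'.lincomb a (?c ` S) = \<zero>\<^bsub>quotient_module M N\<^esub>"
    have a': "(\<lambda>x. a (?c x)) \<in> S \<rightarrow> carrier R" using a by auto
    have "?c (lincomb (\<lambda>x. a (?c x)) S) = N"
      using 0 lincomb_quotient_module[OF S, of a] a by (auto simp: quotient_module_simps)
    then have "lincomb (\<lambda>x. a (?c x)) S \<in> N"
      using coset_eq_submodule_iff closed[OF a'] by blast
    then show "\<forall>v\<in>?c ` S. a v = \<zero>\<^bsub>R\<^esub>" using indep[OF a'] by blast
  qed (use S carr in auto)
  moreover have "Q'.gen_set (?c ` S)"
  proof
    show "Q'.span (?c ` S) \<subseteq> carrier (quotient_module M N)"
      using carr by (rule Q'.span_is_subset2)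
    show "carrier (quotient_module M N) \<subseteq> Q'.span (?c ` S)"
    proof
      fix v assume "v \<in> carrier (quotient_module M N)"
      then obtain x where x: "x \<in> carrier M" "v = ?c x" by (rule carrier_quotient_moduleE)
      then obtain a where a: "a \<in> S \<rightarrow> carrier R" "x \<ominus>\<^bsub>M\<^esub> lincomb a S \<in> N" using gen by blast
      \<comment> \<open>Coefficients given on representatives are carried over to their cosets;
        injectivity makes this possible.\<close>
      define b where "b A = a (the_inv_into S ?c A)" for A
      have b: "b (?c y) = a y" if "y \<in> S" for y
        using that S by (simp add: b_def the_inv_into_f_f)
      have "Q'.lincomb b (?c ` S) = ?c (lincomb (\<lambda>x. b (?c x)) S)"
        using a b by (intro lincomb_quotient_module S) auto
      also have "lincomb (\<lambda>x. b (?c x)) S = lincomb a S"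
        unfolding lincomb_def using S a b by (intro M.finsum_cong') auto
      also have "?c (lincomb a S) = v"
        using coset_eq_iff[OF x(1) closed[OF a(1)]] a(2) x(2) by simp
      finally have v: "Q'.lincomb b (?c ` S) = v" .
      have "b \<in> ?c ` S \<rightarrow> carrier R" using a b by auto
      then show "v \<in> Q'.span (?c ` S)"
        unfolding Q'.finite_span[OF finite_imageI[OF S(1)] carr] using v by blast
    qed
  qed
  ultimately show ?thesis using carr by (simp add: Q'.basis_def)
qed

end

section \<open>Top cohomology\<close>

definition top_form :: "nat \<Rightarrow> ratfun \<Rightarrow> dform" where
  "top_form l f = Poly_Mapping.single {1..l} f"

lemma top_form_simps:
  "top_form l (f + g) = top_form l f + top_form l g"
  "top_form l (- f) = - top_form l f"
  "top_form l 0 = 0"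
  "top_form l f = top_form l g \<longleftrightarrow> f = g"
  "scale_form c (top_form l f) = top_form l (const c * f)"
  by (simp_all add: top_form_def single_add single_uminus inj_eq scale_form_def)

lemma top_form_sum: "top_form l (sum f A) = (\<Sum>x\<in>A. top_form l (f x))"
  by (induction A rule: infinite_finite_induct) (simp_all add: top_form_simps)

lemma forms_top: "forms (l + 3) l = top_form l ` regular l"
proof (intro equalityI subsetI)
  fix \<omega> assume \<omega>: "\<omega> \<in> forms (l + 3) l"
  have keys: "I = {1..l}" if "I \<in> Poly_Mapping.keys \<omega>" for I
    using \<omega> that by (intro card_subset_eq) (auto simp: forms_def)
  have "\<omega> = top_form l (Poly_Mapping.lookup \<omega> {1..l})"
    using keys by (intro poly_mapping_eqI) (auto simp: top_form_def lookup_single when_def in_keys_iff)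
  moreover have "Poly_Mapping.lookup \<omega> {1..l} \<in> regular l"
    using \<omega> regular_0[of l]
    by (cases "{1..l} \<in> Poly_Mapping.keys \<omega>") (auto simp: forms_def regular_def in_keys_iff)
  ultimately show "\<omega> \<in> top_form l ` regular l" by blast
qed (auto simp: forms_def top_form_def regular_def split: if_splits)

lemma ext_d_superset:
  assumes "finite A" "Poly_Mapping.keys \<omega> \<subseteq> A"
  shows "ext_d n \<omega> = (\<Sum>I\<in>A. \<Sum>j\<in>{1..n - 3} - I. Poly_Mapping.single (insert j I)
    ((-1) ^ card {i\<in>I. i < j} * pd j (Poly_Mapping.lookup \<omega> I)))"
  unfolding ext_d_def
  by (rule sum.mono_neutral_left) (use assms in \<open>auto simp: in_keys_iff\<close>)

lemma ext_d_add: "ext_d n (\<omega> + \<eta>) = ext_d n \<omega> + ext_d n \<eta>"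
proof -
  let ?A = "Poly_Mapping.keys \<omega> \<union> Poly_Mapping.keys \<eta>"
  have "Poly_Mapping.keys (\<omega> + \<eta>) \<subseteq> ?A" by (rule Poly_Mapping.keys_add)
  then show ?thesis
    by (subst (1 2 3) ext_d_superset[of ?A])
      (auto simp: lookup_add pd_add distrib_left single_add sum.distrib)
qed

lemma ext_d_0: "ext_d n 0 = 0"
  by (simp add: ext_d_def)

lemma ext_d_sum: "ext_d n (sum f A) = (\<Sum>x\<in>A. ext_d n (f x))"
  by (induction A rule: infinite_finite_induct) (simp_all add: ext_d_0 ext_d_add)

lemma ext_d_single:
  "ext_d n (Poly_Mapping.single I f) = (\<Sum>j\<in>{1..n - 3} - I.
    Poly_Mapping.single (insert j I) ((-1) ^ card {i\<in>I. i < j} * pd j f))"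
  by (subst ext_d_superset[of "{I}"]) auto

text \<open>In top degree no index is left for a further dt_j, so the sum defining d is
  empty.\<close>

lemma closed_forms_top: "closed_forms (l + 3) l = top_form l ` regular l"
  by (auto simp: closed_forms_def forms_top top_form_def ext_d_single)

lemma sign_regular: "f \<in> regular l \<Longrightarrow> (-1) ^ k * f \<in> regular l"
  by (cases "even k") (auto simp: regular_uminus)

text \<open>An index set with l - 1 elements misses exactly one j, so d of such a monomial form is,
  up to sign, the j-th partial derivative of its coefficient. The ring is closed under signs, so
  they do not affect the image.\<close>

lemma exact_forms_top:
  assumes "0 < l"
  shows "exact_forms (l + 3) l = top_form l ` exact_functions l"
proof -
  obtain k where k: "l = Suc k" using assms gr0_implies_Suc by blast
  have single: "ext_d (l + 3) (Poly_Mapping.single ({1..l} - {j}) f) =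
      top_form l ((-1) ^ card {i\<in>{1..l} - {j}. i < j} * pd j f)" if "j \<in> {1..l}" for j f
  proof -
    have "{1..l} - ({1..l} - {j}) = {j}" "insert j ({1..l} - {j}) = {1..l}" using that by auto
    then show ?thesis by (simp add: ext_d_single top_form_def del: insert_Diff_single)
  qed
  have "ext_d (l + 3) ` forms (l + 3) k = top_form l ` exact_functions l"
  proof (intro equalityI subsetI)
    fix \<eta> assume "\<eta> \<in> ext_d (l + 3) ` forms (l + 3) k"
    then obtain \<omega> where \<omega>: "\<omega> \<in> forms (l + 3) k" and \<eta>: "\<eta> = ext_d (l + 3) \<omega>" by blast
    have "\<exists>e\<in>exact_functions l.
        ext_d (l + 3) (Poly_Mapping.single I (Poly_Mapping.lookup \<omega> I)) = top_form l e"
      if I: "I \<in> Poly_Mapping.keys \<omega>" for I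
    proof -
      have I': "I \<subseteq> {1..l}" "card I = k" "Poly_Mapping.lookup \<omega> I \<in> regular l"
        using \<omega> I by (auto simp: forms_def regular_def)
      then have "card ({1..l} - I) = 1"
        using k by (subst card_Diff_subset) (auto intro: finite_subset)
      then obtain j where j: "{1..l} - I = {j}" by (rule card_1_singletonE)
      then have j': "j \<in> {1..l}" "I = {1..l} - {j}" using I' by auto
      let ?s = "(-1) ^ card {i\<in>{1..l} - {j}. i < j}"
      have "?s * pd j (Poly_Mapping.lookup \<omega> I) \<in> exact_functions l"
        using exact_functions_pd[OF I'(3) j'(1)]
        by (cases "even (card {i\<in>{1..l} - {j}. i < j})") (auto simp: exact_functions_uminus)
      moreover have "ext_d (l + 3) (Poly_Mapping.single I (Poly_Mapping.lookup \<omega> I)) =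
          top_form l (?s * pd j (Poly_Mapping.lookup \<omega> I))"
        unfolding j'(2) by (rule single) (rule j'(1))
      ultimately show ?thesis by blast
    qed
    then have "\<forall>I\<in>Poly_Mapping.keys \<omega>. \<exists>e. e \<in> exact_functions l \<and>
        ext_d (l + 3) (Poly_Mapping.single I (Poly_Mapping.lookup \<omega> I)) = top_form l e"
      by blast
    from bchoice[OF this] obtain e where
      e: "\<And>I. I \<in> Poly_Mapping.keys \<omega> \<Longrightarrow> e I \<in> exact_functions l \<and>
        ext_d (l + 3) (Poly_Mapping.single I (Poly_Mapping.lookup \<omega> I)) = top_form l (e I)"
      by blast
    have "\<omega> = (\<Sum>I\<in>Poly_Mapping.keys \<omega>. Poly_Mapping.single I (Poly_Mapping.lookup \<omega> I))"
      by (rule poly_mapping_eqI) (auto simp: lookup_sum lookup_single when_def in_keys_iff)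
    from arg_cong[OF this, of "ext_d (l + 3)"]
    have "\<eta> = (\<Sum>I\<in>Poly_Mapping.keys \<omega>.
        ext_d (l + 3) (Poly_Mapping.single I (Poly_Mapping.lookup \<omega> I)))"
      unfolding \<eta> by (simp only: ext_d_sum)
    also have "\<dots> = top_form l (\<Sum>I\<in>Poly_Mapping.keys \<omega>. e I)"
      by (simp add: top_form_sum e)
    finally show "\<eta> \<in> top_form l ` exact_functions l"
      using exact_functions_sum[of "Poly_Mapping.keys \<omega>" e l] e by blast
  next
    fix \<eta> assume "\<eta> \<in> top_form l ` exact_functions l"
    then obtain h where \<eta>: "\<eta> = top_form l (\<Sum>j\<in>{1..l}. pd j (h j))" and h: "\<And>j. h j \<in> regular l"
      by (auto simp: exact_functions_def)
    \<comment> \<open>The sign of moving dt_j into its place. It squares to 1, so multiplying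
      \<open>h j\<close> by it cancels the sign produced by \<open>ext_d\<close>.\<close>
    define s where "s j = ((-1) ^ card {i\<in>{1..l} - {j}. i < j} :: ratfun)" for j
    define \<omega> where "\<omega> = (\<Sum>j\<in>{1..l}. Poly_Mapping.single ({1..l} - {j}) (s j * h j))"
    have s: "s j * pd j (s j * h j) = pd j (h j)" for j
      by (cases "even (card {i\<in>{1..l} - {j}. i < j})") (auto simp: s_def pd_uminus)
    have "ext_d (l + 3) \<omega> = (\<Sum>j\<in>{1..l}. top_form l (s j * pd j (s j * h j)))"
      unfolding \<omega>_def ext_d_sum s_def by (intro sum.cong refl single)
    then have d: "ext_d (l + 3) \<omega> = \<eta>"
      by (simp only: s \<eta> top_form_sum)
    have lookup: "Poly_Mapping.lookup \<omega> I = (\<Sum>j\<in>{1..l}. if {1..l} - {j} = I then s j * h j else 0)" for I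
      by (simp add: \<omega>_def lookup_sum lookup_single when_def)
    have "I \<subseteq> {1..l} \<and> card I = k \<and> Poly_Mapping.lookup \<omega> I \<in> regular l"
      if I: "I \<in> Poly_Mapping.keys \<omega>" for I
    proof -
      have "\<exists>j\<in>{1..l}. {1..l} - {j} = I"
      proof (rule ccontr)
        assume "\<not> ?thesis"
        then have "Poly_Mapping.lookup \<omega> I = 0"
          unfolding lookup by (intro sum.neutral) auto
        then show False using I by (simp add: in_keys_iff)
      qed
      moreover have "Poly_Mapping.lookup \<omega> I \<in> regular l"
        unfolding lookup s_def using h by (auto intro!: regular_sum sign_regular regular_0)
      ultimately show ?thesis using k by auto
    qed
    then have "\<omega> \<in> forms (l + 3) k" by (simp add: forms_def regular_def)
    then show "\<eta> \<in> ext_d (l + 3) ` forms (l + 3) k" using d by blast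
  qed
  then show ?thesis by (simp add: exact_forms_def k)
qed

lemma closed_module_simps:
  "carrier (closed_module (l + 3) l) = top_form l ` regular l"
  "zero (closed_module (l + 3) l) = 0"
  "add (closed_module (l + 3) l) = (+)"
  "module.smult (closed_module (l + 3) l) = scale_form"
  by (simp_all add: closed_module_def closed_forms_top)

lemma module_closed_module:
  "module (class_ring :: rat ring) (closed_module (l + 3) l)"
proof (rule module_criteria)
  show "cring (class_ring :: rat ring)" by (rule class_cring.is_cring)
  show "\<zero>\<^bsub>closed_module (l + 3) l\<^esub> \<in> carrier (closed_module (l + 3) l)"
    unfolding closed_module_simps top_form_simps(3)[of l, symmetric] by (intro imageI regular_0)
  show "\<forall>v\<in>carrier (closed_module (l + 3) l). \<exists>w\<in>carrier (closed_module (l + 3) l).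
      v \<oplus>\<^bsub>closed_module (l + 3) l\<^esub> w = \<zero>\<^bsub>closed_module (l + 3) l\<^esub>"
  proof
    fix v assume "v \<in> carrier (closed_module (l + 3) l)"
    then have "- v \<in> carrier (closed_module (l + 3) l)"
      by (auto simp: closed_module_simps regular_uminus simp flip: top_form_simps(2))
    then show "\<exists>w\<in>carrier (closed_module (l + 3) l).
        v \<oplus>\<^bsub>closed_module (l + 3) l\<^esub> w = \<zero>\<^bsub>closed_module (l + 3) l\<^esub>"
      by (intro bexI[of _ "- v"]) (simp_all add: closed_module_simps)
  qed
qed (auto simp: closed_module_simps top_form_simps(5) const_mult const_add const_1 algebra_simps
      regular_0 regular_add regular_mult regular_const image_iff
      simp flip: top_form_simps(1,3))

lemma submodule_exact_forms:
  assumes "0 < l"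
  shows "submodule (class_ring :: rat ring) (exact_forms (l + 3) l) (closed_module (l + 3) l)"
proof (rule submodule.intro)
  show "\<zero>\<^bsub>closed_module (l + 3) l\<^esub> \<in> exact_forms (l + 3) l"
    unfolding exact_forms_top[OF assms] closed_module_simps top_form_simps(3)[of l, symmetric]
    using exact_functions_0 by blast
qed (auto simp: exact_forms_top[OF assms] closed_module_simps module_closed_module
      top_form_simps(5) exact_functions_regular exact_functions_add exact_functions_const_mult
      simp flip: top_form_simps(1))

lemma minus_closed_module:
  assumes "v \<in> carrier (closed_module (l + 3) l)" "w \<in> carrier (closed_module (l + 3) l)"
  shows "v \<ominus>\<^bsub>closed_module (l + 3) l\<^esub> w = v - w"
proof -
  interpret module "class_ring :: rat ring" "closed_module (l + 3) l" by (rule module_closed_module)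
  have "- w \<in> carrier (closed_module (l + 3) l)"
    using assms(2) by (auto simp: closed_module_simps regular_uminus simp flip: top_form_simps(2))
  then have "\<ominus>\<^bsub>closed_module (l + 3) l\<^esub> w = - w"
    using assms(2) by (intro M.minus_equality) (simp_all add: closed_module_simps)
  then show ?thesis by (simp add: a_minus_def closed_module_simps)
qed

section \<open>The 01 cell-forms and their classes\<close>

text \<open>For different orderings the difference would be an exact combination with coefficients 1
  and -1. This yields both that the cell-forms are distinct and that their classes are.\<close>

lemma cell_fun_diff_exact_imp_eq:
  assumes "\<pi> \<in> orderings l" "\<rho> \<in> orderings l" "cell_fun \<pi> - cell_fun \<rho> \<in> exact_functions l"
  shows "\<pi> = \<rho>"
proof (rule ccontr)
  assume ne: "\<pi> \<noteq> \<rho>"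
  let ?a = "\<lambda>\<sigma>. (if \<sigma> = \<pi> then 1 else 0) + (- 1) * (if \<sigma> = \<rho> then 1 else 0)"
  have "cell_comb l ?a = cell_fun \<pi> - cell_fun \<rho>"
    unfolding cell_comb_add cell_comb_mult cell_comb_indicator[OF assms(1)]
      cell_comb_indicator[OF assms(2)]
    by (simp add: const_uminus const_1)
  then have "cell_comb l ?a \<in> exact_functions l" using assms(3) by (simp only:)
  from cell_comb_exact_imp_0[OF this assms(1)] show False using ne by simp
qed

lemma inj_on_cell_fun: "inj_on cell_fun (orderings l)"
proof (rule inj_onI)
  fix \<pi> \<rho> assume "\<pi> \<in> orderings l" "\<rho> \<in> orderings l" "cell_fun \<pi> = cell_fun \<rho>"
  then show "\<pi> = \<rho>"
    by (intro cell_fun_diff_exact_imp_eq[of \<pi> l \<rho>]) (simp_all add: exact_functions_0)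
qed

lemma cell_forms_01_eq: "cell_forms_01 (l + 3) = (\<lambda>\<pi>. top_form l (cell_fun \<pi>)) ` orderings l"
  unfolding cell_forms_01_def cell_form_eq top_form_def orderings_def add_diff_cancel_right'
  by blast

lemma inj_on_top_cell: "inj_on (\<lambda>\<pi>. top_form l (cell_fun \<pi>)) (orderings l)"
  using inj_on_cell_fun by (auto simp: inj_on_def top_form_simps)

lemma card_orderings: "card (orderings l) = fact (Suc l)"
proof -
  have "card (insert Pt_inf (Pt_t ` {1..l})) = Suc l"
    by (subst card_insert_disjoint) (auto simp: card_image inj_on_def)
  then show ?thesis
    by (simp only: orderings_def card_permutations_of_set finite_insert finite_imageI finite_atLeastAtMost)
qed

lemma lincomb_cell_forms_01:
  "module.lincomb (closed_module (l + 3) l) a (cell_forms_01 (l + 3)) =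
    top_form l (cell_comb l (\<lambda>\<pi>. a (top_form l (cell_fun \<pi>))))"
proof -
  interpret module "class_ring :: rat ring" "closed_module (l + 3) l" by (rule module_closed_module)
  have finsum: "finsum (closed_module (l + 3) l) f S = sum f S"
    if "finite S" "f \<in> S \<rightarrow> carrier (closed_module (l + 3) l)" for f :: "dform \<Rightarrow> dform" and S
    using that by (induction S rule: finite_induct) (auto simp: closed_module_simps Pi_iff)
  have "lincomb a (cell_forms_01 (l + 3)) = (\<Sum>v\<in>cell_forms_01 (l + 3). scale_form (a v) v)"
    unfolding lincomb_def closed_module_simps
    by (rule finsum) (auto simp: cell_forms_01_eq closed_module_simps top_form_simps
        regular_mult regular_const cell_fun_regular)
  also have "\<dots> = (\<Sum>\<pi>\<in>orderings l. scale_form (a (top_form l (cell_fun \<pi>))) (top_form l (cell_fun \<pi>)))"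
    unfolding cell_forms_01_eq by (rule sum.reindex_cong[OF inj_on_top_cell]) auto
  also have "\<dots> = top_form l (cell_comb l (\<lambda>\<pi>. a (top_form l (cell_fun \<pi>))))"
    by (simp add: top_form_simps cell_comb_def top_form_sum)
  finally show ?thesis .
qed

theorem theorem2p12:
  fixes n :: nat
  assumes "n \<ge> 4"
  shows "card (cell_forms_01 n) = fact (n - 2) \<and>
    vectorspace (class_ring :: rat ring) (de_Rham n (n - 3)) \<and>
    inj_on (de_Rham_class n (n - 3)) (cell_forms_01 n) \<and>
    vectorspace.basis (class_ring :: rat ring) (de_Rham n (n - 3))
      (de_Rham_class n (n - 3) ` cell_forms_01 n)"
proof -
  define l where "l = n - 3"
  have n: "n = l + 3" and l: "0 < l" using assms by (simp_all add: l_def)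
  let ?M = "closed_module (l + 3) l" and ?N = "exact_forms (l + 3) l" and ?S = "cell_forms_01 (l + 3)"
  note sub = submodule_exact_forms[OF l]
  note N = exact_forms_top[OF l]
  have S: "finite ?S" "?S \<subseteq> carrier ?M"
    by (auto simp: cell_forms_01_eq closed_module_simps cell_fun_regular)
  have inj: "inj_on (\<lambda>v. ?N +>\<^bsub>?M\<^esub> v) ?S"
  proof (rule inj_onI)
    fix v w assume vw: "v \<in> ?S" "w \<in> ?S" "?N +>\<^bsub>?M\<^esub> v = ?N +>\<^bsub>?M\<^esub> w"
    then have "v - w \<in> ?N"
      using coset_eq_iff[OF sub] minus_closed_module[of v l w] S by (simp add: subset_iff)
    moreover obtain \<pi> \<rho> where "\<pi> \<in> orderings l" "v = top_form l (cell_fun \<pi>)"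
        "\<rho> \<in> orderings l" "w = top_form l (cell_fun \<rho>)"
      using vw by (auto simp: cell_forms_01_eq)
    moreover have "top_form l f - top_form l g = top_form l (f - g)" for f g
      using top_form_simps(1)[of l f "- g"] top_form_simps(2)[of l g] by simp
    ultimately show "v = w"
      using cell_fun_diff_exact_imp_eq[of \<pi> l \<rho>] by (auto simp: N top_form_simps(4))
  qed
  have basis: "vectorspace.basis (class_ring :: rat ring) (quotient_module ?M ?N)
      ((\<lambda>v. ?N +>\<^bsub>?M\<^esub> v) ` ?S)"
  proof (rule basis_quotient_module[OF sub class_field S inj])
    fix v assume v: "v \<in> carrier ?M"
    then obtain f where f: "v = top_form l f" "f \<in> regular l" by (auto simp: closed_module_simps)
    then obtain a where a: "f - cell_comb l a \<in> exact_functions l"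
      using regular_subset_cell_span[of f l] by (auto simp: cell_span_def)
    \<comment> \<open>\<open>cell_comb\<close> takes coefficients indexed by orderings,
      \<open>lincomb\<close> by forms; the injectivity of the indexing translates one into the
      other.\<close>
    define b where "b v = a (the_inv_into (orderings l) (\<lambda>\<pi>. top_form l (cell_fun \<pi>)) v)" for v
    have "b (top_form l (cell_fun \<pi>)) = a \<pi>" if "\<pi> \<in> orderings l" for \<pi>
      using the_inv_into_f_f[OF inj_on_top_cell that] by (simp add: b_def)
    then have comb: "module.lincomb ?M b ?S = top_form l (cell_comb l a)"
      unfolding lincomb_cell_forms_01 by (simp add: cell_comb_def)
    have "cell_comb l a \<in> regular l"
      unfolding cell_comb_def by (intro regular_sum regular_mult regular_const cell_fun_regular)
    then have "v \<ominus>\<^bsub>?M\<^esub> module.lincomb ?M b ?S = v - top_form l (cell_comb l a)"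
      unfolding comb using v by (intro minus_closed_module) (auto simp: closed_module_simps)
    also have "\<dots> = top_form l (f - cell_comb l a)"
      using top_form_simps(1)[of l f "- cell_comb l a"] top_form_simps(2)[of l "cell_comb l a"]
      by (simp add: f)
    also have "\<dots> \<in> ?N" using a by (simp add: N)
    finally show "\<exists>a\<in>?S \<rightarrow> carrier (class_ring :: rat ring). v \<ominus>\<^bsub>?M\<^esub> module.lincomb ?M a ?S \<in> ?N"
      by (intro bexI[of _ b]) auto
  next
    fix a :: "dform \<Rightarrow> rat" and v
    assume "module.lincomb ?M a ?S \<in> ?N" "v \<in> ?S"
    then have "cell_comb l (\<lambda>\<pi>. a (top_form l (cell_fun \<pi>))) \<in> exact_functions l"
      unfolding lincomb_cell_forms_01 N by (auto simp: top_form_simps(4))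
    from cell_comb_exact_imp_0[OF this] show "a v = \<zero>\<^bsub>class_ring\<^esub>"
      using \<open>v \<in> ?S\<close> by (auto simp: cell_forms_01_eq)
  qed
  have "card ?S = fact (Suc l)"
    unfolding cell_forms_01_eq card_image[OF inj_on_top_cell] by (rule card_orderings)
  moreover have "de_Rham_class (l + 3) l = (\<lambda>v. ?N +>\<^bsub>?M\<^esub> v)"
    by (simp add: de_Rham_class_def fun_eq_iff)
  ultimately show ?thesis
    using basis inj vectorspace_quotient_module[OF sub class_field]
    by (simp add: n de_Rham_def)
qed

end
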